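(* Let $\mu$ be a partition and $k\ge1$ an integer. The following are equivalent: (A) there exists a partition $\lambda$ with $\lambda_1\le k$ and $r_\lambda^\mu>0$; (B) $D(\mu)\le 2^{k-1}$.
   Context: $r_\lambda^\mu=\dim\operatorname{Hom}_{\mathfrak S_n}(V_\mu,\mathbb{S}^\lambda\mathbb{C}^n)$ with $n=|\mu|$, where $V_\mu$ is the Specht module, $\mathbb{S}^\lambda$ the Schur functor over $\mathbb{C}$, and $\mathfrak S_n$ acts on $\mathbb{C}^n$ by permutation matrices. $D(\mu)$ is the size of the Durfee square of $\mu$: the largest integer $d\ge0$ with $\mu_d\ge d$. *)

theory Defs
  imports Complex_Main "HOL-Library.Function_Algebras" "HOL-Combinatorics.Permutations"
begin

definition is_partition :: "nat list \<Rightarrow> bool" where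
  "is_partition lam \<longleftrightarrow> sorted_wrt (\<ge>) lam \<and> (\<forall>x\<in>set lam. 0 < x)"

definition part :: "nat list \<Rightarrow> nat \<Rightarrow> nat" where
  "part lam i = (if 1 \<le> i \<and> i \<le> length lam then lam ! (i - 1) else 0)"

definition durfee :: "nat list \<Rightarrow> nat" where
  "durfee mu = (GREATEST d. d \<le> part mu d)"

section \<open>The canonical Young tableau of shape lam (row reading, entries 0..|lam|-1)\<close>

definition row_of :: "nat list \<Rightarrow> nat \<Rightarrow> nat" where
  "row_of lam x = card {i. 1 \<le> i \<and> i \<le> length lam \<and> sum_list (take i lam) \<le> x}"

definition col_of :: "nat list \<Rightarrow> nat \<Rightarrow> nat" where
  "col_of lam x = x - sum_list (take (row_of lam x) lam)"

definition row_group :: "nat list \<Rightarrow> (nat \<Rightarrow> nat) set" where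
  "row_group lam = {p. p permutes {..<sum_list lam} \<and>
      (\<forall>x<sum_list lam. row_of lam (p x) = row_of lam x)}"

definition col_group :: "nat list \<Rightarrow> (nat \<Rightarrow> nat) set" where
  "col_group lam = {q. q permutes {..<sum_list lam} \<and>
      (\<forall>x<sum_list lam. col_of lam (q x) = col_of lam x)}"

section \<open>Representations realised as subspaces of complex-valued function spaces\<close>

definition Sym :: "nat \<Rightarrow> (nat \<Rightarrow> nat) set" where
  "Sym n = {s. s permutes {..<n}}"

definition equiv_hom ::
  "'g set \<Rightarrow> ('a \<Rightarrow> complex) set \<Rightarrow> ('g \<Rightarrow> ('a \<Rightarrow> complex) \<Rightarrow> ('a \<Rightarrow> complex))
   \<Rightarrow> ('b \<Rightarrow> complex) set \<Rightarrow> ('g \<Rightarrow> ('b \<Rightarrow> complex) \<Rightarrow> ('b \<Rightarrow> complex))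
   \<Rightarrow> (('a \<Rightarrow> complex) \<Rightarrow> ('b \<Rightarrow> complex)) set" where
  "equiv_hom G V rho W tau = {f.
      (\<forall>v\<in>V. f v \<in> W) \<and>
      (\<forall>c u v. u \<in> V \<longrightarrow> v \<in> V \<longrightarrow>
          f (\<lambda>x. c * u x + v x) = (\<lambda>y. c * f u y + f v y)) \<and>
      (\<forall>g\<in>G. \<forall>v\<in>V. f (rho g v) = tau g (f v)) \<and>
      (\<forall>v. v \<notin> V \<longrightarrow> f v = (\<lambda>_. 0))}"

definition hom_dim ::
  "'g set \<Rightarrow> ('a \<Rightarrow> complex) set \<Rightarrow> ('g \<Rightarrow> ('a \<Rightarrow> complex) \<Rightarrow> ('a \<Rightarrow> complex))
   \<Rightarrow> ('b \<Rightarrow> complex) set \<Rightarrow> ('g \<Rightarrow> ('b \<Rightarrow> complex) \<Rightarrow> ('b \<Rightarrow> complex)) \<Rightarrow> nat" where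
  "hom_dim G V rho W tau =
     vector_space.dim (\<lambda>(c::complex) (F :: ('a \<Rightarrow> complex) \<Rightarrow> ('b \<Rightarrow> complex)). \<lambda>v y. c * F v y)
       (equiv_hom G V rho W tau)"

section \<open>Specht module V_mu = C[S_n] c_mu (Fulton--Harris), n = |mu|\<close>

definition group_alg :: "nat \<Rightarrow> ((nat \<Rightarrow> nat) \<Rightarrow> complex) set" where
  "group_alg n = {x. \<forall>g. x g \<noteq> 0 \<longrightarrow> g \<in> Sym n}"

definition conv :: "nat \<Rightarrow> ((nat \<Rightarrow> nat) \<Rightarrow> complex) \<Rightarrow> ((nat \<Rightarrow> nat) \<Rightarrow> complex)
    \<Rightarrow> ((nat \<Rightarrow> nat) \<Rightarrow> complex)" where
  "conv n x y = (\<lambda>g. \<Sum>h\<in>Sym n. x h * y (inv h \<circ> g))"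

definition delta :: "(nat \<Rightarrow> nat) \<Rightarrow> ((nat \<Rightarrow> nat) \<Rightarrow> complex)" where
  "delta h = (\<lambda>g. if g = h then 1 else 0)"

definition young_sym_alg :: "nat list \<Rightarrow> ((nat \<Rightarrow> nat) \<Rightarrow> complex)" where
  "young_sym_alg mu = conv (sum_list mu)
      (\<lambda>g. \<Sum>p\<in>row_group mu. delta p g)
      (\<lambda>g. \<Sum>q\<in>col_group mu. of_int (sign q) * delta q g)"

definition specht :: "nat list \<Rightarrow> ((nat \<Rightarrow> nat) \<Rightarrow> complex) set" where
  "specht mu = {conv (sum_list mu) x (young_sym_alg mu) | x. x \<in> group_alg (sum_list mu)}"

definition specht_act :: "(nat \<Rightarrow> nat) \<Rightarrow> ((nat \<Rightarrow> nat) \<Rightarrow> complex) \<Rightarrow> ((nat \<Rightarrow> nat) \<Rightarrow> complex)" where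
  "specht_act s x = (\<lambda>g. x (inv s \<circ> g))"

text \<open>(C^n)^{tensor m}: coefficient functions on words of length m over {0..n-1}.\<close>
definition tensor_space :: "nat \<Rightarrow> nat \<Rightarrow> (nat list \<Rightarrow> complex) set" where
  "tensor_space n m = {T. \<forall>w. T w \<noteq> 0 \<longrightarrow> length w = m \<and> set w \<subseteq> {..<n}}"

definition pos_act :: "(nat \<Rightarrow> nat) \<Rightarrow> (nat list \<Rightarrow> complex) \<Rightarrow> (nat list \<Rightarrow> complex)" where
  "pos_act p T = (\<lambda>w. T (permute_list p w))"

text \<open>Diagonal action of S_n on (C^n)^{tensor m} by permutation matrices: s e_w = e_{map s w}.\<close>
definition tensor_act :: "(nat \<Rightarrow> nat) \<Rightarrow> (nat list \<Rightarrow> complex) \<Rightarrow> (nat list \<Rightarrow> complex)" where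
  "tensor_act s T = (\<lambda>w. T (map (inv s) w))"

definition young_sym_tensor :: "nat list \<Rightarrow> (nat list \<Rightarrow> complex) \<Rightarrow> (nat list \<Rightarrow> complex)" where
  "young_sym_tensor lam T =
     (\<lambda>w. \<Sum>p\<in>row_group lam. pos_act p
            (\<lambda>u. \<Sum>q\<in>col_group lam. of_int (sign q) * pos_act q T u) w)"

definition schur_module :: "nat list \<Rightarrow> nat \<Rightarrow> (nat list \<Rightarrow> complex) set" where
  "schur_module lam n = young_sym_tensor lam ` tensor_space n (sum_list lam)"

definition r_mult :: "nat list \<Rightarrow> nat list \<Rightarrow> nat" where
  "r_mult lam mu = hom_dim (Sym (sum_list mu)) (specht mu) specht_act
                      (schur_module lam (sum_list mu)) tensor_act"

end

theory Submission
  imports Defs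
begin

text \<open>The Schur modules of the partitions with at most \<open>k\<close> columns are the constituents of the \<open>k\<close>-fold
  tensor power of the exterior algebra of \<open>\<complex>\<^sup>n\<close>. As a representation of the symmetric group this is the
  \<open>n\<close>-fold super tensor power of the exterior algebra of \<open>\<complex>\<^sup>k\<close>, whose basis has \<open>d = 2\<^sup>k\<^sup>-\<^sup>1\<close> even and
  \<open>d\<close> odd elements (the subsets of \<open>{..<k}\<close>, sorted by parity), so by the hook theorem of Berele and Regev
  \<open>\<mu>\<close> occurs if and only if its row number \<open>d + 1\<close> has length at most \<open>d\<close>.

  If \<open>\<mu>\<close> occurs, then evaluating the image of the Young symmetrizer along a word gives a function on
  permutations which is invariant, or alternating, on the letters that occur in the same even, or odd, set
  of columns, and which satisfies the Garnir relations; an extremal choice of the permutation bounds row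
  \<open>d + 1\<close>. Conversely, a filling of \<open>\<mu>\<close> whose first \<open>d\<close> rows carry the even subsets and whose
  remaining columns carry the odd ones gives a vector not killed by the Young symmetrizer.

  In both directions a Capelli-type computation shows that the column antisymmetrizer of a shape does not
  kill a nonzero row invariant vector satisfying the Garnir relations (and dually, with rows and columns
  and signs exchanged). Such vectors exist in every nonzero representation: take an alternating vector
  for a set partition whose block sizes have the largest sum of squares.\<close>

section \<open>Representations of symmetric groups\<close>

text \<open>Two commuting actions on tensors drive everything: one symmetric group moves the
  \<open>m\<close> places, the other renames the \<open>n\<close> letters. Parity enters through
  their interplay. If two letters occur in the same set \<open>A\<close> of columns, exchanging them
  in a word amounts to one place transposition in each of these columns, so on column-alternating
  tensors it costs the sign (-1)^|A|. Half of the subsets of \<open>{..<k}\<close> are even, whence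
  2^(k-1); and a Durfee square of size at most \<open>d\<close> means exactly that row
  \<open>d + 1\<close> has length at most \<open>d\<close>. The obstacle is nonvanishing. Specht and
  Schur modules are both defined with the row symmetrizer applied after the column antisymmetrizer,
  so the generator and the tensors are row invariant, whereas the sign rule needs column
  alternation, and a further symmetrizer or antisymmetrizer might produce zero. The Garnir relations
  exclude this, because they turn the relevant averages into positive integer multiples of vectors
  already known to be nonzero.\<close>

lemma transpose_conjugate:
  assumes "bij g"
  shows "g \<circ> transpose x y = transpose (g x) (g y) \<circ> g"
  using assms by (auto simp: fun_eq_iff transpose_def bij_def inj_eq)

section \<open>Young subgroups, given as stabilizers of label functions\<close>

definition label_stabilizer :: "nat set \<Rightarrow> (nat \<Rightarrow> nat) \<Rightarrow> (nat \<Rightarrow> nat) set" where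
  "label_stabilizer \<Omega> f = {p. p permutes \<Omega> \<and> (\<forall>x\<in>\<Omega>. f (p x) = f x)}"

lemma label_stabilizerD:
  assumes "p \<in> label_stabilizer \<Omega> f"
  shows "p permutes \<Omega>" and "x \<in> \<Omega> \<Longrightarrow> f (p x) = f x"
  using assms by (auto simp: label_stabilizer_def)

lemma id_in_label_stabilizer: "id \<in> label_stabilizer \<Omega> f"
  by (simp add: label_stabilizer_def permutes_id)

lemma comp_in_label_stabilizer:
  assumes "p \<in> label_stabilizer \<Omega> f" "q \<in> label_stabilizer \<Omega> f"
  shows "p \<circ> q \<in> label_stabilizer \<Omega> f"
  using assms by (auto simp: label_stabilizer_def permutes_compose permutes_in_image)

lemma inv_in_label_stabilizer:
  assumes "p \<in> label_stabilizer \<Omega> f"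
  shows "inv p \<in> label_stabilizer \<Omega> f"
proof -
  have p: "p permutes \<Omega>" using assms by (rule label_stabilizerD)
  have "f (inv p x) = f x" if "x \<in> \<Omega>" for x
    using label_stabilizerD(2)[OF assms, of "inv p x"] that p
    by (metis permutes_in_image permutes_inv permutes_inverses(1))
  then show ?thesis using p by (simp add: label_stabilizer_def permutes_inv)
qed

lemma finite_label_stabilizer: "finite \<Omega> \<Longrightarrow> finite (label_stabilizer \<Omega> f)"
  using finite_permutations[of \<Omega>] by (auto simp: label_stabilizer_def)

lemma transpose_in_label_stabilizer:
  assumes "x \<in> \<Omega>" "y \<in> \<Omega>" "f x = f y"
  shows "transpose x y \<in> label_stabilizer \<Omega> f"
  using assms by (auto simp: label_stabilizer_def permutes_swap_id transpose_def)

lemma bij_betw_comp_right_label_stabilizer: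
  assumes "g \<in> label_stabilizer \<Omega> f"
  shows "bij_betw (\<lambda>p. p \<circ> g) (label_stabilizer \<Omega> f) (label_stabilizer \<Omega> f)"
proof (rule bij_betwI[where g = "\<lambda>p. p \<circ> inv g"])
  have *: "g \<circ> inv g = id" "inv g \<circ> g = id"
    using permutes_inv_o[OF label_stabilizerD(1)[OF assms]] by auto
  show "x \<circ> g \<circ> inv g = x" "x \<circ> inv g \<circ> g = x" for x :: "nat \<Rightarrow> nat"
    by (simp_all add: o_assoc[symmetric] *)
qed (use assms in \<open>auto intro: comp_in_label_stabilizer inv_in_label_stabilizer\<close>)

lemma bij_betw_comp_left_label_stabilizer:
  assumes "g \<in> label_stabilizer \<Omega> f"
  shows "bij_betw (\<lambda>p. g \<circ> p) (label_stabilizer \<Omega> f) (label_stabilizer \<Omega> f)"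
proof (rule bij_betwI[where g = "\<lambda>p. inv g \<circ> p"])
  have *: "g \<circ> inv g = id" "inv g \<circ> g = id"
    using permutes_inv_o[OF label_stabilizerD(1)[OF assms]] by auto
  show "inv g \<circ> (g \<circ> x) = x" "g \<circ> (inv g \<circ> x) = x" for x :: "nat \<Rightarrow> nat"
    by (simp_all add: o_assoc *)
qed (use assms in \<open>auto intro: comp_in_label_stabilizer inv_in_label_stabilizer\<close>)

text \<open>Transpositions inside the blocks generate a Young subgroup: following \<open>p\<close>
  by the transposition of \<open>x\<close> and \<open>p x\<close>, which carry the same label, makes
  \<open>x\<close> a fixed point and moves no new point. Invariance and alternation therefore need
  checking on transpositions only.\<close>

lemma label_stabilizer_induct [consumes 2, case_names id swap]:
  assumes "finite \<Omega>" "p \<in> label_stabilizer \<Omega> f"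
    and id: "P id"
    and swap: "\<And>x y p. \<lbrakk>x \<in> \<Omega>; y \<in> \<Omega>; x \<noteq> y; f x = f y; p \<in> label_stabilizer \<Omega> f; P p\<rbrakk>
                 \<Longrightarrow> P (transpose x y \<circ> p)"
  shows "P p"
  using assms(2)
proof (induction "card {x. p x \<noteq> x}" arbitrary: p rule: less_induct)
  case less
  show ?case
  proof (cases "p = id")
    case True
    then show ?thesis using id by simp
  next
    case False
    then obtain x where x: "p x \<noteq> x" by (auto simp: fun_eq_iff)
    have p: "p permutes \<Omega>" using less.prems by (rule label_stabilizerD)
    have xO: "x \<in> \<Omega>" using x p by (meson permutes_not_in)
    have pxO: "p x \<in> \<Omega>" using xO p by (simp add: permutes_in_image)
    have fx: "f (p x) = f x" using label_stabilizerD(2)[OF less.prems xO] .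
    let ?p = "transpose x (p x) \<circ> p"
    have mem: "?p \<in> label_stabilizer \<Omega> f"
      using transpose_in_label_stabilizer[OF xO pxO, of f] fx less.prems
      by (intro comp_in_label_stabilizer) auto
    have fin: "finite {x. p x \<noteq> x}"
      using assms(1) by (rule rev_finite_subset) (use permutes_not_in[OF p] in auto)
    have "{z. ?p z \<noteq> z} \<subset> {z. p z \<noteq> z}"
    proof
      show "{z. ?p z \<noteq> z} \<subseteq> {z. p z \<noteq> z}"
        using x permutes_inj[OF p] by (auto simp: transpose_def inj_eq split: if_splits)
      show "{z. ?p z \<noteq> z} \<noteq> {z. p z \<noteq> z}"
        using x by (auto simp: set_eq_iff intro!: exI[of _ x])
    qed
    then have "P ?p" using less.hyps[of ?p] mem fin by (simp add: psubset_card_mono)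
    then have "P (transpose x (p x) \<circ> ?p)"
      using swap[of x "p x" ?p] xO pxO x fx mem by simp
    then show ?thesis by (simp add: o_assoc)
  qed
qed

section \<open>Linear actions of a symmetric group, symmetrizers and antisymmetrizers\<close>

locale perm_rep = vector_space scale
  for scale :: "complex \<Rightarrow> 'v::ab_group_add \<Rightarrow> 'v" (infixr \<open>*s\<close> 75) +
  fixes \<Omega> :: "nat set" and act :: "(nat \<Rightarrow> nat) \<Rightarrow> 'v \<Rightarrow> 'v"
  assumes fin: "finite \<Omega>"
    and act_id: "act id v = v"
    and act_comp: "\<lbrakk>g permutes \<Omega>; h permutes \<Omega>\<rbrakk> \<Longrightarrow> act (g \<circ> h) v = act g (act h v)"
    and act_add: "g permutes \<Omega> \<Longrightarrow> act g (u + v) = act g u + act g v"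
    and act_scale: "g permutes \<Omega> \<Longrightarrow> act g (c *s v) = c *s act g v"
begin

definition stab_sum :: "(nat \<Rightarrow> nat) \<Rightarrow> 'v \<Rightarrow> 'v" where
  "stab_sum f v = (\<Sum>p\<in>label_stabilizer \<Omega> f. act p v)"

definition stab_alt :: "(nat \<Rightarrow> nat) \<Rightarrow> 'v \<Rightarrow> 'v" where
  "stab_alt f v = (\<Sum>p\<in>label_stabilizer \<Omega> f. of_int (sign p) *s act p v)"

definition sym_sum :: "nat set \<Rightarrow> 'v \<Rightarrow> 'v" where
  "sym_sum S v = (\<Sum>p | p permutes S. act p v)"

lemma act_zero: "g permutes \<Omega> \<Longrightarrow> act g 0 = 0"
  using act_add[of g 0 0] by simp

lemma act_minus: "g permutes \<Omega> \<Longrightarrow> act g (- v) = - act g v"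
  using act_add[of g v "- v"] by (simp add: act_zero minus_unique)

lemma act_sum: "g permutes \<Omega> \<Longrightarrow> act g (sum h I) = (\<Sum>i\<in>I. act g (h i))"
  by (induction I rule: infinite_finite_induct) (simp_all add: act_zero act_add)

lemma act_inv_cancel: "g permutes \<Omega> \<Longrightarrow> act (inv g) (act g v) = v"
  by (metis act_comp act_id permutes_inv permutes_inv_o(2))

lemma act_eq_0_iff: "g permutes \<Omega> \<Longrightarrow> act g v = 0 \<longleftrightarrow> v = 0"
  by (metis act_inv_cancel act_zero permutes_inv)

lemma act_conj:
  assumes "g permutes \<Omega>" "x \<in> \<Omega>" "y \<in> \<Omega>"
  shows "act g (act (transpose x y) v) = act (transpose (g x) (g y)) (act g v)"
proof -
  have "act (g \<circ> transpose x y) v = act (transpose (g x) (g y) \<circ> g) v"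
    using transpose_conjugate[OF permutes_bij[OF assms(1)]] by simp
  then show ?thesis
    using assms by (simp add: act_comp permutes_swap_id permutes_in_image)
qed

lemma act_swap_swap:
  assumes "x \<in> \<Omega>" "y \<in> \<Omega>"
  shows "act (transpose x y) (act (transpose x y) v) = v"
  using assms by (metis act_comp act_id permutes_swap_id transpose_comp_involutory)

lemma eq_neg_self_imp_0: "(v::'v) = - v \<Longrightarrow> v = 0"
proof -
  assume "v = - v"
  then have "v + v = 0" by (metis ab_left_minus)
  then have "(1 + 1) *s v = 0" by (simp only: scale_left_distrib scale_one)
  then show ?thesis by simp
qed

lemma sym_sum_add: "S \<subseteq> \<Omega> \<Longrightarrow> sym_sum S (u + v) = sym_sum S u + sym_sum S v"
  unfolding sym_sum_def sum.distrib[symmetric] using permutes_subset by (intro sum.cong refl act_add) auto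

lemma sym_sum_scale: "S \<subseteq> \<Omega> \<Longrightarrow> sym_sum S (c *s v) = c *s sym_sum S v"
  unfolding sym_sum_def scale_sum_right using permutes_subset by (intro sum.cong refl act_scale) auto

lemma sym_sum_minus: "S \<subseteq> \<Omega> \<Longrightarrow> sym_sum S (- v) = - sym_sum S v"
  using sym_sum_scale[of S "-1" v] by simp

lemma sym_sum_zero: "S \<subseteq> \<Omega> \<Longrightarrow> sym_sum S 0 = 0"
  using sym_sum_scale[of S 0 0] by simp

lemma sym_sum_sum: "S \<subseteq> \<Omega> \<Longrightarrow> sym_sum S (sum h I) = (\<Sum>i\<in>I. sym_sum S (h i))"
  by (induction I rule: infinite_finite_induct) (simp_all add: sym_sum_zero sym_sum_add)

lemma sym_sum_conj:
  assumes g: "g permutes \<Omega>" and S: "S \<subseteq> \<Omega>"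
  shows "act g (sym_sum S v) = sym_sum (g ` S) (act g v)"
proof -
  have b: "bij g" using g by (rule permutes_bij)
  have gi: "g \<circ> inv g = id" "inv g \<circ> g = id"
    using permutes_inv_o[OF g] by auto
  have per: "h \<circ> p \<circ> inv h permutes h ` A" if "bij h" "p permutes A" for h p :: "nat \<Rightarrow> nat" and A
  proof (rule bij_imp_permutes)
    have "bij_betw (inv h) (h ` A) A"
      using that(1) by (metis bij_betw_inv_into_subset bij_betw_imp_surj_on bij_is_inj inj_on_imp_bij_betw inj_on_subset subset_UNIV)
    moreover have "bij_betw h A (h ` A)"
      using that(1) by (simp add: bij_betw_def inj_on_subset[OF bij_is_inj])
    ultimately show "bij_betw (h \<circ> p \<circ> inv h) (h ` A) (h ` A)"
      using permutes_imp_bij[OF that(2)] by (metis bij_betw_trans)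
    show "(h \<circ> p \<circ> inv h) x = x" if "x \<notin> h ` A" for x
    proof -
      have "h (inv h x) = x" using \<open>bij h\<close> by (simp add: bij_is_surj surj_f_inv_f)
      moreover from this that have "inv h x \<notin> A" by force
      ultimately show ?thesis using permutes_not_in[OF \<open>p permutes A\<close>, of "inv h x"] by simp
    qed
  qed
  have "bij_betw (\<lambda>p. g \<circ> p \<circ> inv g) {p. p permutes S} {p. p permutes (g ` S)}"
  proof (rule bij_betwI[where g = "\<lambda>p. inv g \<circ> p \<circ> g"])
    show "(\<lambda>p. g \<circ> p \<circ> inv g) \<in> {p. p permutes S} \<rightarrow> {p. p permutes (g ` S)}"
      using per[OF b] by auto
    show "(\<lambda>p. inv g \<circ> p \<circ> g) \<in> {p. p permutes (g ` S)} \<rightarrow> {p. p permutes S}"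
    proof
      fix p assume "p \<in> {p. p permutes (g ` S)}"
      then have "inv g \<circ> p \<circ> inv (inv g) permutes inv g ` g ` S"
        using per[of "inv g" p "g ` S"] b by (simp add: bij_imp_bij_inv)
      then show "inv g \<circ> p \<circ> g \<in> {p. p permutes S}"
        using b by (simp add: inv_inv_eq image_comp gi)
    qed
    show "inv g \<circ> (g \<circ> x \<circ> inv g) \<circ> g = x" "g \<circ> (inv g \<circ> x \<circ> g) \<circ> inv g = x" for x :: "nat \<Rightarrow> nat"
      using b by (auto simp: fun_eq_iff bij_is_inj bij_is_surj surj_f_inv_f)
  qed
  then have "sym_sum (g ` S) (act g v) = (\<Sum>p | p permutes S. act (g \<circ> p \<circ> inv g) (act g v))"
    unfolding sym_sum_def by (rule sum.reindex_bij_betw[symmetric])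
  also have "\<dots> = (\<Sum>p | p permutes S. act g (act p v))"
  proof (rule sum.cong)
    fix p assume "p \<in> {p. p permutes S}"
    then have p: "p permutes \<Omega>" using S permutes_subset by auto
    show "act (g \<circ> p \<circ> inv g) (act g v) = act g (act p v)"
      using p g by (simp add: act_comp permutes_inv permutes_compose act_inv_cancel)
  qed simp
  also have "\<dots> = act g (sym_sum S v)"
    using g by (simp add: sym_sum_def act_sum)
  finally show ?thesis by simp
qed

lemma sym_sum_absorb:
  assumes S: "S \<subseteq> \<Omega>" and h: "h permutes S"
  shows "sym_sum S (act h v) = sym_sum S v"
proof -
  have "sym_sum S v = (\<Sum>p | p permutes S. act (p \<circ> h) v)"
    unfolding sym_sum_def using sum_permutations_compose_right[OF h] by (simp add: o_def)
  also have "\<dots> = sym_sum S (act h v)"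
    unfolding sym_sum_def using S h permutes_subset by (intro sum.cong refl act_comp) auto
  finally show ?thesis by simp
qed

lemma sym_sum_eq_0:
  assumes S: "S \<subseteq> \<Omega>" and xy: "x \<in> S" "y \<in> S" and neg: "act (transpose x y) v = - v"
  shows "sym_sum S v = 0"
proof -
  have "sym_sum S v = sym_sum S (act (transpose x y) v)"
    using sym_sum_absorb[OF S permutes_swap_id[OF xy]] by simp
  also have "\<dots> = - sym_sum S v" using S neg by (simp add: sym_sum_minus)
  finally show ?thesis by (rule eq_neg_self_imp_0)
qed

text \<open>Coset decomposition of the symmetric group of \<open>insert a S\<close> over that of
  \<open>S\<close>, with the transpositions moved to the inside. In this form a sum of
  transpositions as in a Garnir relation is recognized as part of a larger symmetrization.\<close>

lemma sym_sum_insert: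
  assumes a: "a \<in> \<Omega>" "a \<notin> S" and S: "S \<subseteq> \<Omega>"
  shows "sym_sum (insert a S) v = sym_sum S (v + (\<Sum>s\<in>S. act (transpose a s) v))"
proof -
  have finS: "finite S" using S fin by (rule finite_subset)
  have "sym_sum (insert a S) v = (\<Sum>b\<in>insert a S. \<Sum>p | p permutes S. act (transpose a b \<circ> p) v)"
    unfolding sym_sum_def by (rule sum_over_permutations_insert[OF finS a(2)])
  also have "\<dots> = (\<Sum>b\<in>insert a S. \<Sum>p | p permutes S. act (transpose a b) (act p v))"
    using a S permutes_subset[OF _ S] by (intro sum.cong refl act_comp) (auto intro: permutes_swap_id)
  also have "\<dots> = (\<Sum>p | p permutes S. \<Sum>b\<in>insert a S. act (transpose a b) (act p v))"
    by (rule sum.swap)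
  also have "\<dots> = (\<Sum>p | p permutes S. act p (v + (\<Sum>s\<in>S. act (transpose a s) v)))"
  proof (rule sum.cong)
    fix p assume "p \<in> {p. p permutes S}"
    then have p: "p permutes S" and pO: "p permutes \<Omega>" using S permutes_subset by auto
    have pa: "p a = a" using p a by (auto simp: permutes_def)
    have "(\<Sum>b\<in>S. act (transpose a b) (act p v)) = (\<Sum>b\<in>S. act (transpose a (p b)) (act p v))"
      by (rule sum.reindex_bij_betw[symmetric]) (rule permutes_imp_bij[OF p])
    also have "\<dots> = (\<Sum>b\<in>S. act p (act (transpose a b) v))"
      using S a(1) act_conj[OF pO, of a] pa by (intro sum.cong) auto
    finally show "(\<Sum>b\<in>insert a S. act (transpose a b) (act p v))
        = act p (v + (\<Sum>s\<in>S. act (transpose a s) v))"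
      using finS a pO by (simp add: act_add act_sum act_id[unfolded id_def] act_id)
  qed simp
  also have "\<dots> = sym_sum S (v + (\<Sum>s\<in>S. act (transpose a s) v))"
    by (simp add: sym_sum_def)
  finally show ?thesis .
qed

lemma stab_sum_absorb:
  assumes "h \<in> label_stabilizer \<Omega> f"
  shows "stab_sum f (act h v) = stab_sum f v"
proof -
  have "stab_sum f v = (\<Sum>p\<in>label_stabilizer \<Omega> f. act (p \<circ> h) v)"
    unfolding stab_sum_def
    by (rule sum.reindex_bij_betw[OF bij_betw_comp_right_label_stabilizer[OF assms], symmetric])
  also have "\<dots> = stab_sum f (act h v)"
    unfolding stab_sum_def using assms by (intro sum.cong) (auto simp: act_comp label_stabilizerD(1))
  finally show ?thesis by simp
qed

lemma act_stab_sum: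
  assumes "h \<in> label_stabilizer \<Omega> f"
  shows "act h (stab_sum f v) = stab_sum f v"
proof -
  have "stab_sum f v = (\<Sum>p\<in>label_stabilizer \<Omega> f. act (h \<circ> p) v)"
    unfolding stab_sum_def
    by (rule sum.reindex_bij_betw[OF bij_betw_comp_left_label_stabilizer[OF assms], symmetric])
  also have "\<dots> = act h (stab_sum f v)"
    unfolding stab_sum_def using assms by (subst act_sum) (auto simp: act_comp label_stabilizerD(1) intro!: sum.cong)
  finally show ?thesis by simp
qed

lemma stab_sum_add: "stab_sum f (u + v) = stab_sum f u + stab_sum f v"
  unfolding stab_sum_def sum.distrib[symmetric] by (intro sum.cong refl act_add) (rule label_stabilizerD(1))

lemma stab_sum_scale: "stab_sum f (c *s v) = c *s stab_sum f v"
  unfolding stab_sum_def scale_sum_right by (intro sum.cong refl act_scale) (rule label_stabilizerD(1))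

lemma stab_sum_zero: "stab_sum f 0 = 0"
  using stab_sum_scale[of f 0 0] by simp

lemma stab_sum_sum: "stab_sum f (sum h I) = (\<Sum>i\<in>I. stab_sum f (h i))"
  by (induction I rule: infinite_finite_induct) (simp_all add: stab_sum_zero stab_sum_add)

text \<open>Constant labels on \<open>S\<close> put its symmetric group inside the stabilizer, so a
  preliminary symmetrization over \<open>S\<close> contributes only a factorial. This lets rows be
  symmetrized one at a time.\<close>

lemma stab_sum_sym_sum:
  assumes S: "S \<subseteq> \<Omega>" and f: "\<And>x y. \<lbrakk>x \<in> S; y \<in> S\<rbrakk> \<Longrightarrow> f x = f y"
  shows "stab_sum f (sym_sum S v) = of_nat (card {p. p permutes S}) *s stab_sum f v"
proof -
  have "p \<in> label_stabilizer \<Omega> f" if "p permutes S" for p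
  proof -
    have "f (p x) = f x" for x
      using f[of "p x" x] that by (cases "x \<in> S") (auto simp: permutes_in_image permutes_not_in)
    then show ?thesis using that permutes_subset[OF that S] by (simp add: label_stabilizer_def)
  qed
  then have "stab_sum f (sym_sum S v) = (\<Sum>p | p permutes S. stab_sum f v)"
    unfolding sym_sum_def[of S] stab_sum_sum by (intro sum.cong) (auto simp: stab_sum_absorb)
  then show ?thesis by (simp add: sum_constant_scale)
qed

lemma act_invariant_label_stabilizer:
  assumes "\<And>x y. \<lbrakk>x \<in> \<Omega>; y \<in> \<Omega>; x \<noteq> y; f x = f y\<rbrakk> \<Longrightarrow> act (transpose x y) v = v"
    and "p \<in> label_stabilizer \<Omega> f"
  shows "act p v = v"
  using fin assms(2)
proof (induction rule: label_stabilizer_induct)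
  case id
  then show ?case by (rule act_id)
next
  case (swap x y p)
  then show ?case using assms(1) by (metis act_comp permutes_swap_id label_stabilizerD(1))
qed

lemma stab_sum_invariant:
  assumes "\<And>x y. \<lbrakk>x \<in> \<Omega>; y \<in> \<Omega>; x \<noteq> y; f x = f y\<rbrakk> \<Longrightarrow> act (transpose x y) v = v"
  shows "stab_sum f v = of_nat (card (label_stabilizer \<Omega> f)) *s v"
  using act_invariant_label_stabilizer[OF assms]
  by (simp add: stab_sum_def sum_constant_scale)

lemma card_label_stabilizer_pos: "card (label_stabilizer \<Omega> f) > 0"
  using id_in_label_stabilizer finite_label_stabilizer[OF fin] by (metis card_gt_0_iff empty_iff)

lemma permutation_of_permutes: "p permutes \<Omega> \<Longrightarrow> permutation p"
  using fin permutation_permutes by blast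

text \<open>Tensoring with the sign character exchanges \<open>stab_sum\<close> and
  \<open>stab_alt\<close>; facts on signed sums follow by applying those on plain sums to the
  twisted action.\<close>

lemma sign_twist: "perm_rep scale \<Omega> (\<lambda>g v. of_int (sign g) *s act g v)"
proof unfold_locales
  show "finite \<Omega>" by (rule fin)
  show "of_int (sign id) *s act id v = v" for v by (simp add: act_id)
  show "of_int (sign (g \<circ> h)) *s act (g \<circ> h) v = of_int (sign g) *s act g (of_int (sign h) *s act h v)"
    if "g permutes \<Omega>" "h permutes \<Omega>" for g h v
    using that by (simp add: act_comp act_scale sign_compose permutation_of_permutes)
  show "of_int (sign g) *s act g (u + v) = of_int (sign g) *s act g u + of_int (sign g) *s act g v"
    if "g permutes \<Omega>" for g u v using that by (simp add: act_add scale_right_distrib)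
  show "of_int (sign g) *s act g (c *s v) = c *s of_int (sign g) *s act g v"
    if "g permutes \<Omega>" for g c v using that by (simp add: act_scale mult.commute)
qed

lemma stab_alt_eq_twist: "stab_alt f v = perm_rep.stab_sum \<Omega> (\<lambda>g v. of_int (sign g) *s act g v) f v"
  by (simp add: stab_alt_def perm_rep.stab_sum_def[OF sign_twist])

lemma act_swap_stab_alt:
  assumes "x \<in> \<Omega>" "y \<in> \<Omega>" "x \<noteq> y" "f x = f y"
  shows "act (transpose x y) (stab_alt f v) = - stab_alt f v"
proof -
  have "of_int (sign (transpose x y)) *s act (transpose x y) (stab_alt f v) = stab_alt f v"
    using perm_rep.act_stab_sum[OF sign_twist transpose_in_label_stabilizer[OF assms(1,2,4)], of v]
    by (simp add: stab_alt_eq_twist)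
  then have "- act (transpose x y) (stab_alt f v) = stab_alt f v"
    using assms by (simp add: sign_swap_id)
  then show ?thesis by (metis minus_minus)
qed

lemma stab_alt_absorb:
  assumes "h \<in> label_stabilizer \<Omega> f"
  shows "stab_alt f (act h v) = of_int (sign h) *s stab_alt f v"
proof -
  have "of_int (sign h) *s stab_alt f (act h v) = stab_alt f v"
    using perm_rep.stab_sum_absorb[OF sign_twist assms, of v]
      perm_rep.stab_sum_scale[OF sign_twist, of f "of_int (sign h)" "act h v"]
    by (simp add: stab_alt_eq_twist)
  then have "of_int (sign h) *s of_int (sign h) *s stab_alt f (act h v) = of_int (sign h) *s stab_alt f v"
    by simp
  then show ?thesis by (simp flip: of_int_mult)
qed

lemma act_alternating_label_stabilizer:
  assumes "\<And>x y. \<lbrakk>x \<in> \<Omega>; y \<in> \<Omega>; x \<noteq> y; f x = f y\<rbrakk> \<Longrightarrow> act (transpose x y) v = - v"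
    and "p \<in> label_stabilizer \<Omega> f"
  shows "act p v = of_int (sign p) *s v"
proof -
  have "of_int (sign p) *s act p v = v"
    using perm_rep.act_invariant_label_stabilizer[OF sign_twist _ assms(2), of v] assms(1)
    by (simp add: sign_swap_id)
  then have "of_int (sign p) *s of_int (sign p) *s act p v = of_int (sign p) *s v" by simp
  then show ?thesis by (simp flip: of_int_mult)
qed

lemma stab_alt_alternating:
  assumes "\<And>x y. \<lbrakk>x \<in> \<Omega>; y \<in> \<Omega>; x \<noteq> y; f x = f y\<rbrakk> \<Longrightarrow> act (transpose x y) v = - v"
  shows "stab_alt f v = of_nat (card (label_stabilizer \<Omega> f)) *s v"
  using act_alternating_label_stabilizer[OF assms]
  by (simp add: stab_alt_def sum_constant_scale flip: of_int_mult)

end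

section \<open>Vectors satisfying the Garnir relations\<close>

context perm_rep
begin

text \<open>Row \<open>J\<close> is symmetrized cell by cell from its right end. When the cell
  \<open>z\<close> of column \<open>t\<close> joins the set \<open>?S\<close> of cells to its right,
  summing over all cells \<open>y\<close> of the column in place of \<open>z\<close> gives a
  positive multiple of the symmetrization over \<open>?S\<close>. Alternation in the column makes
  the choices of \<open>y\<close> equivalent up to sign, so if the choice \<open>z\<close> gave
  zero, all would. Only rows from \<open>J\<close> on take part, as earlier rows are already
  symmetrized.\<close>

lemma alternating_vector_step_nonzero:
  fixes c r :: "nat \<Rightarrow> nat"
  assumes anti: "\<And>x y. \<lbrakk>x \<in> \<Omega>; y \<in> \<Omega>; x \<noteq> y; c x = c y; J \<le> r x; J \<le> r y\<rbrakk> \<Longrightarrow> act (transpose x y) v = - v"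
    and rel: "\<And>y i. \<lbrakk>y \<in> \<Omega>; J \<le> r y; i < c y\<rbrakk> \<Longrightarrow>
                (\<Sum>x | x \<in> \<Omega> \<and> c x = i \<and> J \<le> r x. act (transpose x y) v) = v"
    and inj: "inj_on (\<lambda>x. (c x, r x)) \<Omega>"
    and v: "v \<noteq> 0"
  shows "sym_sum {x \<in> \<Omega>. r x = J} v \<noteq> 0"
proof -
  define S where "S t = {x \<in> \<Omega>. r x = J \<and> t \<le> c x}" for t :: nat
  have SO: "S t \<subseteq> \<Omega>" for t by (auto simp: S_def)
  have finS: "finite (S t)" for t using SO fin by (rule finite_subset)
  obtain M where M: "\<And>x. x \<in> \<Omega> \<Longrightarrow> c x < M"
    using fin by (metis finite_imageI finite_nat_set_iff_bounded imageI)
  have "sym_sum (S t) v \<noteq> 0" if "t \<le> M" for t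
    using that
  proof (induction rule: inc_induct)
    case base
    have "S M = {}" using M by (force simp: S_def)
    then show ?case using v by (simp add: sym_sum_def act_id)
  next
    case (step t)
    show ?case
    proof (cases "\<exists>z\<in>\<Omega>. r z = J \<and> c z = t")
      case False
      then have "S t = S (Suc t)" by (auto simp: S_def Suc_le_eq order.strict_iff_order)
      then show ?thesis using step.IH by simp
    next
      case True
      then obtain z where z: "z \<in> \<Omega>" "r z = J" "c z = t" by blast
      let ?S = "S (Suc t)"
      define R where "R = {y \<in> \<Omega>. c y = t \<and> J \<le> r y}"
      have zR: "z \<in> R" using z by (simp add: R_def)
      have finR: "finite R" using fin by (simp add: R_def)
      have St: "S t = insert z ?S"
        using z inj by (auto simp: S_def Suc_le_eq order.strict_iff_order inj_on_def)
      have nin: "y \<notin> ?S" if "y \<in> R" for y using that by (auto simp: R_def S_def)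
      have "(\<Sum>y\<in>R. sym_sum (insert y ?S) v)
          = (\<Sum>y\<in>R. sym_sum ?S (v + (\<Sum>s\<in>?S. act (transpose y s) v)))"
        using nin by (intro sum.cong refl sym_sum_insert SO) (auto simp: R_def)
      also have "\<dots> = sym_sum ?S (\<Sum>y\<in>R. v + (\<Sum>s\<in>?S. act (transpose y s) v))"
        by (simp add: sym_sum_sum SO)
      also have "(\<Sum>y\<in>R. v + (\<Sum>s\<in>?S. act (transpose y s) v))
          = (\<Sum>y\<in>R. v) + (\<Sum>s\<in>?S. \<Sum>y\<in>R. act (transpose y s) v)"
        by (simp only: sum.distrib sum.swap[of _ R])
      \<comment> \<open>Each \<open>s\<close> lies strictly to the right of column \<open>t\<close>,
        so its relation with that column collapses the inner sum to \<open>v\<close>. All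
        contributions are thus positive multiples of \<open>v\<close>.\<close>
      also have "(\<Sum>s\<in>?S. \<Sum>y\<in>R. act (transpose y s) v) = (\<Sum>s\<in>?S. v)"
      proof (rule sum.cong)
        fix s assume "s \<in> ?S"
        then show "(\<Sum>y\<in>R. act (transpose y s) v) = v"
          using rel[of s t] by (auto simp: S_def R_def)
      qed simp
      also have "(\<Sum>y\<in>R. v) + (\<Sum>s\<in>?S. v) = of_nat (card R + card ?S) *s v"
        by (simp add: sum_constant_scale scale_left_distrib)
      finally have total: "(\<Sum>y\<in>R. sym_sum (insert y ?S) v) = of_nat (card R + card ?S) *s sym_sum ?S v"
        by (simp add: sym_sum_scale SO)
      show ?thesis
      proof
        assume zero: "sym_sum (S t) v = 0"
        have "sym_sum (insert y ?S) v = 0" if y: "y \<in> R" for y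
        proof (cases "y = z")
          case True
          then show ?thesis using zero St by simp
        next
          case False
          have yO: "y \<in> \<Omega>" using y by (simp add: R_def)
          let ?t = "transpose z y"
          have t: "?t permutes \<Omega>" using z yO by (simp add: permutes_swap_id)
          have neg: "act ?t v = - v" using anti[of z y] z y False by (auto simp: R_def)
          have "?t ` ?S = ?S" using nin[OF y] nin[OF zR] by (simp add: transpose_image_eq)
          then have "insert y ?S = ?t ` insert z ?S" by simp
          then have "sym_sum (insert y ?S) (act ?t v) = act ?t (sym_sum (insert z ?S) v)"
            using sym_sum_conj[OF t, of "insert z ?S" v] z SO by simp
          also have "\<dots> = 0" using zero St t by (simp add: act_zero)
          finally have "sym_sum (insert y ?S) (- v) = 0" by (simp add: neg)
          then show ?thesis using yO SO by (simp add: sym_sum_minus)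
        qed
        then have "of_nat (card R + card ?S) *s sym_sum ?S v = 0" using total by simp
        moreover have "card R > 0" using zR finR by (auto simp: card_gt_0_iff)
        ultimately have "sym_sum ?S v = 0"
          by (metis add_eq_0_iff_both_eq_0 not_gr_zero of_nat_eq_0_iff scale_eq_0_iff)
        then show False using step.IH by simp
      qed
    qed
  qed
  from this[of 0] show ?thesis by (simp add: S_def)
qed

text \<open>A Capelli-type argument: symmetrising one row at a time multiplies, in the average over the
  choices of the row, by a positive integer, and leaves a vector of the same kind on the remaining rows.\<close>

lemma stab_sum_nonzero_aux:
  fixes c r :: "nat \<Rightarrow> nat"
  assumes down: "\<And>x i j. \<lbrakk>x \<in> \<Omega>; i \<le> c x; j \<le> r x\<rbrakk> \<Longrightarrow> \<exists>z\<in>\<Omega>. c z = i \<and> r z = j"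
    and inj: "inj_on (\<lambda>x. (c x, r x)) \<Omega>"
    and bound: "\<And>x. x \<in> \<Omega> \<Longrightarrow> r x < M" and "J \<le> M"
    and "\<And>x y. \<lbrakk>x \<in> \<Omega>; y \<in> \<Omega>; x \<noteq> y; c x = c y; J \<le> r x; J \<le> r y\<rbrakk> \<Longrightarrow> act (transpose x y) v = - v"
    and "\<And>y i. \<lbrakk>y \<in> \<Omega>; J \<le> r y; i < c y\<rbrakk> \<Longrightarrow>
                (\<Sum>x | x \<in> \<Omega> \<and> c x = i \<and> J \<le> r x. act (transpose x y) v) = v"
    and "\<And>x y. \<lbrakk>x \<in> \<Omega>; y \<in> \<Omega>; x \<noteq> y; r x = r y; r x < J\<rbrakk> \<Longrightarrow> act (transpose x y) v = v"
    and "v \<noteq> 0"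
  shows "stab_sum r v \<noteq> 0"
  using assms(4-)
proof (induction J arbitrary: v rule: inc_induct)
  case base
  then have "stab_sum r v = of_nat (card (label_stabilizer \<Omega> r)) *s v"
    using bound by (intro stab_sum_invariant) auto
  then show ?case using base card_label_stabilizer_pos[of r] by simp
next
  case (step J)
  note anti = step.prems(1) and rel = step.prems(2) and invar = step.prems(3)
  define S where "S = {x \<in> \<Omega>. r x = J}"
  have SO: "S \<subseteq> \<Omega>" by (auto simp: S_def)
  have comm: "act (transpose x y) (sym_sum S u) = sym_sum S (act (transpose x y) u)"
    if "x \<in> \<Omega>" "y \<in> \<Omega>" "x \<notin> S" "y \<notin> S" for x y u
    using sym_sum_conj[OF permutes_swap_id[OF that(1,2)] SO] that by (simp add: transpose_image_eq)
  have "stab_sum r (sym_sum S v) \<noteq> 0"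
  proof (rule step.IH)
    show "sym_sum S v \<noteq> 0"
      unfolding S_def using anti rel inj step.prems(4) by (rule alternating_vector_step_nonzero)
  next
    fix x y assume xy: "x \<in> \<Omega>" "y \<in> \<Omega>" "x \<noteq> y" "c x = c y" "Suc J \<le> r x" "Suc J \<le> r y"
    then have "act (transpose x y) v = - v" by (intro anti) auto
    then show "act (transpose x y) (sym_sum S v) = - sym_sum S v"
      using comm[of x y v] xy by (simp add: S_def sym_sum_minus)
  next
    fix x y assume xy: "x \<in> \<Omega>" "y \<in> \<Omega>" "x \<noteq> y" "r x = r y" "r x < Suc J"
    show "act (transpose x y) (sym_sum S v) = sym_sum S v"
    proof (cases "r x = J")
      case True
      then have mem: "x \<in> S" "y \<in> S" using xy by (auto simp: S_def)
      have t: "transpose x y permutes \<Omega>" using xy by (simp add: permutes_swap_id)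
      have "act (transpose x y) (sym_sum S v) = sym_sum S (act (transpose x y) v)"
        using sym_sum_conj[OF t SO] mem by (simp add: transpose_image_eq)
      then show ?thesis using sym_sum_absorb[OF SO permutes_swap_id[OF mem]] by simp
    next
      case False
      then show ?thesis using comm[of x y v] xy invar[of x y] by (simp add: S_def)
    qed
  next
    fix y i assume y: "y \<in> \<Omega>" "Suc J \<le> r y" "i < c y"
    obtain z where z: "z \<in> \<Omega>" "c z = i" "r z = J" using down[of y i J] y by auto
    obtain z' where z': "z' \<in> \<Omega>" "c z' = c y" "r z' = J" using down[of y "c y" J] y by auto
    let ?A = "{x. x \<in> \<Omega> \<and> c x = i \<and> J \<le> r x}" and ?B = "{x. x \<in> \<Omega> \<and> c x = i \<and> Suc J \<le> r x}"
    have A: "?A = insert z ?B"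
      using z inj by (auto simp: inj_on_def Suc_le_eq order.strict_iff_order)
    have "z \<notin> ?B" using z by simp
    then have "v = act (transpose z y) v + (\<Sum>x\<in>?B. act (transpose x y) v)"
      using rel[of y i] y A fin by simp
    then have "sym_sum S v = sym_sum S (act (transpose z y) v + (\<Sum>x\<in>?B. act (transpose x y) v))"
      by (rule arg_cong)
    also have "\<dots> = sym_sum S (act (transpose z y) v) + (\<Sum>x\<in>?B. sym_sum S (act (transpose x y) v))"
      by (simp only: sym_sum_add[OF SO] sym_sum_sum[OF SO])
    also have "(\<Sum>x\<in>?B. sym_sum S (act (transpose x y) v)) = (\<Sum>x\<in>?B. act (transpose x y) (sym_sum S v))"
      using y by (intro sum.cong refl comm[symmetric]) (auto simp: S_def)
    \<comment> \<open>The term of the cell \<open>z\<close>, which leaves the relation, dies: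
      \<open>v\<close> is alternating in \<open>y\<close> and \<open>z'\<close>, cells of one
      column, hence \<open>act (transpose z y) v\<close> is alternating in \<open>z\<close> and
      \<open>z'\<close>, two cells of the symmetrized row.\<close>
    also have "sym_sum S (act (transpose z y) v) = 0"
    proof (rule sym_sum_eq_0[OF SO])
      show "z \<in> S" "z' \<in> S" using z z' by (auto simp: S_def)
      have ne: "z \<noteq> z'" "y \<noteq> z'" "y \<noteq> z" using y z z' by auto
      have t: "transpose z y permutes \<Omega>" using z y by (simp add: permutes_swap_id)
      have "act (transpose z y) (act (transpose y z') v) = act (transpose z z') (act (transpose z y) v)"
        using act_conj[OF t y(1) z'(1)] ne by simp
      moreover have "act (transpose y z') v = - v" using anti[of y z'] y z' ne by auto
      ultimately show "act (transpose z z') (act (transpose z y) v) = - act (transpose z y) v"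
        using t by (simp add: act_minus)
    qed
    finally show "(\<Sum>x\<in>?B. act (transpose x y) (sym_sum S v)) = sym_sum S v"
      unfolding add_0_left by (rule sym)
  qed
  then show ?case
    using stab_sum_sym_sum[OF SO, of r v] by (auto simp: S_def)
qed

text \<open>The hypothesis for \<open>i < c y\<close> is the one-cell Garnir relation: for
  \<open>v\<close> alternating on column \<open>i\<close>, it says that antisymmetrizing over this
  column together with \<open>y\<close> gives zero.\<close>

lemma stab_sum_nonzero:
  fixes c r :: "nat \<Rightarrow> nat"
  assumes "\<And>x i j. \<lbrakk>x \<in> \<Omega>; i \<le> c x; j \<le> r x\<rbrakk> \<Longrightarrow> \<exists>z\<in>\<Omega>. c z = i \<and> r z = j"
    and "inj_on (\<lambda>x. (c x, r x)) \<Omega>"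
    and "\<And>x y. \<lbrakk>x \<in> \<Omega>; y \<in> \<Omega>; x \<noteq> y; c x = c y\<rbrakk> \<Longrightarrow> act (transpose x y) v = - v"
    and "\<And>y i. \<lbrakk>y \<in> \<Omega>; i < c y\<rbrakk> \<Longrightarrow> (\<Sum>x | x \<in> \<Omega> \<and> c x = i. act (transpose x y) v) = v"
    and "v \<noteq> 0"
  shows "stab_sum r v \<noteq> 0"
proof -
  obtain M where M: "\<And>x. x \<in> \<Omega> \<Longrightarrow> r x < M"
    using fin by (metis finite_imageI finite_nat_set_iff_bounded imageI)
  show ?thesis
    by (rule stab_sum_nonzero_aux[where J = 0 and M = M and c = c]) (use assms M in auto)
qed

text \<open>This is the sign-twisted form with rows and columns exchanged: the twist turns row
  invariance into alternation and the plus sign of the row relation into the minus sign of the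
  column relation.\<close>

lemma stab_alt_nonzero:
  fixes c r :: "nat \<Rightarrow> nat"
  assumes "\<And>x i j. \<lbrakk>x \<in> \<Omega>; i \<le> c x; j \<le> r x\<rbrakk> \<Longrightarrow> \<exists>z\<in>\<Omega>. c z = i \<and> r z = j"
    and "inj_on (\<lambda>x. (c x, r x)) \<Omega>"
    and "\<And>x y. \<lbrakk>x \<in> \<Omega>; y \<in> \<Omega>; x \<noteq> y; r x = r y\<rbrakk> \<Longrightarrow> act (transpose x y) v = v"
    and rel: "\<And>y i. \<lbrakk>y \<in> \<Omega>; i < r y\<rbrakk> \<Longrightarrow> v + (\<Sum>x | x \<in> \<Omega> \<and> r x = i. act (transpose x y) v) = 0"
    and "v \<noteq> 0"
  shows "stab_alt c v \<noteq> 0"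
  unfolding stab_alt_eq_twist
proof (rule perm_rep.stab_sum_nonzero[OF sign_twist, where c = r])
  show "\<exists>z\<in>\<Omega>. r z = i \<and> c z = j" if "x \<in> \<Omega>" "i \<le> r x" "j \<le> c x" for x i j
    using assms(1) that by blast
  show "inj_on (\<lambda>x. (r x, c x)) \<Omega>" using assms(2) by (auto simp: inj_on_def)
  show "of_int (sign (transpose x y)) *s act (transpose x y) v = - v"
    if "x \<in> \<Omega>" "y \<in> \<Omega>" "x \<noteq> y" "r x = r y" for x y
    using that assms(3) by (simp add: sign_swap_id)
  show "(\<Sum>x | x \<in> \<Omega> \<and> r x = i. of_int (sign (transpose x y)) *s act (transpose x y) v) = v"
    if "y \<in> \<Omega>" "i < r y" for y i
  proof -
    have "(\<Sum>x | x \<in> \<Omega> \<and> r x = i. of_int (sign (transpose x y)) *s act (transpose x y) v)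
        = (\<Sum>x | x \<in> \<Omega> \<and> r x = i. - act (transpose x y) v)"
      using that by (intro sum.cong) (auto simp: sign_swap_id)
    then show ?thesis using rel[OF that] by (simp add: sum_negf minus_unique[symmetric] add_eq_0_iff2)
  qed
qed (rule assms(5))

text \<open>The relation expresses symmetrization over row \<open>i\<close> together with a lower
  cell \<open>y\<close>. On a column-alternating \<open>u\<close> this gives zero, since row
  \<open>i\<close> has a cell in the column of \<open>y\<close>. Row symmetrization of
  \<open>u\<close> moves \<open>y\<close> only within its own row, where the same reason
  applies.\<close>

lemma stab_sum_alternating_relation:
  fixes c r :: "nat \<Rightarrow> nat"
  assumes down: "\<And>x i j. \<lbrakk>x \<in> \<Omega>; i \<le> c x; j \<le> r x\<rbrakk> \<Longrightarrow> \<exists>z\<in>\<Omega>. c z = i \<and> r z = j"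
    and anti: "\<And>x y. \<lbrakk>x \<in> \<Omega>; y \<in> \<Omega>; x \<noteq> y; c x = c y\<rbrakk> \<Longrightarrow> act (transpose x y) u = - u"
    and y: "y \<in> \<Omega>" "i < r y"
  shows "stab_sum r u + (\<Sum>x | x \<in> \<Omega> \<and> r x = i. act (transpose x y) (stab_sum r u)) = 0"
proof -
  define H where "H = {x. x \<in> \<Omega> \<and> r x = i}"
  define P where "P = label_stabilizer \<Omega> r"
  define W where "W y = u + (\<Sum>x\<in>H. act (transpose x y) u)" for y
  \<comment> \<open>Pulling the row permutation \<open>p\<close> out to the left of each
    transposition replaces \<open>y\<close> by \<open>inv p y\<close>, a cell of the same row.
    \<open>T\<close> is the left-hand side of the relation in this form.\<close>
  define T where "T = (\<Sum>p\<in>P. act p (W (inv p y)))"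
  have HO: "H \<subseteq> \<Omega>" by (auto simp: H_def)
  have Pp: "p permutes \<Omega>" if "p \<in> P" for p using that by (simp add: P_def label_stabilizer_def)
  have W0: "sym_sum H (W y') = 0" if y': "y' \<in> \<Omega>" "i < r y'" for y'
  proof -
    obtain x0 where x0: "x0 \<in> \<Omega>" "c x0 = c y'" "r x0 = i" using down[OF y'(1) order_refl less_imp_le[OF y'(2)]] by auto
    have "y' \<notin> H" using that by (auto simp: H_def)
    then have "sym_sum (insert y' H) u = sym_sum H (W y')"
      using sym_sum_insert[OF that(1) _ HO, of u] by (simp add: W_def transpose_commute)
    moreover have "sym_sum (insert y' H) u = 0"
    proof (rule sym_sum_eq_0)
      show "act (transpose x0 y') u = - u" using anti[of x0 y'] x0 that by auto
    qed (use HO that x0 in \<open>auto simp: H_def\<close>)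
    ultimately show ?thesis by simp
  qed
  have HP: "h \<in> P" if "h permutes H" for h
  proof -
    have "r (h x) = r x" for x
      using that permutes_in_image[OF that, of x] permutes_not_in[OF that, of x]
      by (cases "x \<in> H") (auto simp: H_def)
    then show ?thesis using permutes_subset[OF that HO] by (simp add: P_def label_stabilizer_def)
  qed
  have invy: "inv p y \<in> \<Omega>" "r (inv p y) = r y" if "p \<in> P" for p
    using inv_in_label_stabilizer[of p \<Omega> r] that y by (auto simp: P_def label_stabilizer_def permutes_in_image)
  have "stab_sum r u + (\<Sum>x\<in>H. act (transpose x y) (stab_sum r u)) = T"
  proof -
    have step: "act (transpose x y) (act p u) = act p (act (transpose (inv p x) (inv p y)) u)"
      if "p \<in> P" "x \<in> H" for p x
      using act_conj[OF Pp[OF that(1)], of "inv p x" "inv p y" u] that HO y Pp[OF that(1)]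
      by (auto simp: permutes_inv permutes_in_image permutes_inverses)
    have row: "(\<Sum>x\<in>H. act p (act (transpose (inv p x) (inv p y)) u))
        = (\<Sum>x\<in>H. act p (act (transpose x (inv p y)) u))" if "p \<in> P" for p
    proof (rule sum.reindex_bij_betw)
      have ip: "inv p \<in> label_stabilizer \<Omega> r" using that by (simp add: P_def inv_in_label_stabilizer)
      show "bij_betw (inv p) H H"
      proof (rule bij_betw_byWitness[where f' = p])
        show "inv p ` H \<subseteq> H" "p ` H \<subseteq> H"
          using ip that by (auto simp: H_def P_def label_stabilizer_def permutes_in_image)
      qed (use Pp[OF that] in \<open>auto simp: permutes_inverses\<close>)
    qed
    have "(\<Sum>x\<in>H. act (transpose x y) (stab_sum r u))
        = (\<Sum>x\<in>H. \<Sum>p\<in>P. act (transpose x y) (act p u))"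
      unfolding stab_sum_def P_def using HO y by (intro sum.cong refl act_sum permutes_swap_id) auto
    also have "\<dots> = (\<Sum>p\<in>P. \<Sum>x\<in>H. act (transpose x y) (act p u))" by (rule sum.swap)
    also have "\<dots> = (\<Sum>p\<in>P. act p (\<Sum>x\<in>H. act (transpose x (inv p y)) u))"
      using step row by (intro sum.cong) (auto simp: act_sum Pp)
    finally show ?thesis
      unfolding T_def W_def stab_sum_def P_def[symmetric] sum.distrib[symmetric]
      by (simp add: act_add Pp sum.distrib)
  qed
  moreover have "T = 0"
  proof -
    \<comment> \<open>Right multiplication by permutations of row \<open>i\<close> only reindexes
      the sum over \<open>p\<close>, and these permutations fix \<open>inv p y\<close>. Averaging
      over them produces the symmetrizations that vanish by \<open>W0\<close>.\<close>
    have shift: "T = (\<Sum>p\<in>P. act p (act h (W (inv p y))))" if h: "h permutes H" for h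
    proof -
      have hO: "h permutes \<Omega>" using h HO by (rule permutes_subset)
      have "T = (\<Sum>p\<in>P. act (p \<circ> h) (W (inv (p \<circ> h) y)))"
        unfolding T_def P_def
        by (rule sum.reindex_bij_betw[symmetric], rule bij_betw_comp_right_label_stabilizer)
           (use HP[OF h] in \<open>simp add: P_def\<close>)
      also have "\<dots> = (\<Sum>p\<in>P. act p (act h (W (inv p y))))"
      proof (rule sum.cong)
        fix p assume p: "p \<in> P"
        have "inv (p \<circ> h) y = inv h (inv p y)"
          using Pp[OF p] hO by (simp add: o_inv_distrib permutes_bij)
        moreover have "inv h (inv p y) = inv p y"
          using permutes_not_in[OF permutes_inv[OF h], of "inv p y"] invy[OF p] y by (auto simp: H_def)
        ultimately show "act (p \<circ> h) (W (inv (p \<circ> h) y)) = act p (act h (W (inv p y)))"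
          using Pp[OF p] hO by (simp add: act_comp)
      qed simp
      finally show ?thesis .
    qed
    have "of_nat (card {h. h permutes H}) *s T = (\<Sum>h | h permutes H. T)"
      by (simp add: sum_constant_scale)
    also have "\<dots> = (\<Sum>h | h permutes H. \<Sum>p\<in>P. act p (act h (W (inv p y))))"
      using shift by (intro sum.cong) auto
    also have "\<dots> = (\<Sum>p\<in>P. act p (sym_sum H (W (inv p y))))"
      by (subst sum.swap) (auto simp: sym_sum_def act_sum Pp intro!: sum.cong)
    also have "\<dots> = 0" using W0 invy y by (intro sum.neutral) (auto simp: act_zero Pp)
    finally show ?thesis
      using finite_subset[OF HO fin] by (simp add: card_permutations[OF refl])
  qed
  ultimately show ?thesis by (simp add: H_def)
qed

end

section \<open>Alternating vectors for set partitions with extremal block sizes\<close>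

lemma card_equal_label_pairs:
  assumes "finite \<Omega>" "y \<in> \<Omega>"
  shows "card {(x, z). x \<in> \<Omega> \<and> z \<in> \<Omega> \<and> c x = c z}
    = card {(x, z). x \<in> \<Omega> - {y} \<and> z \<in> \<Omega> - {y} \<and> c x = c z} + 2 * card {z \<in> \<Omega> - {y}. c z = c y} + 1"
proof -
  let ?A = "{(x, z). x \<in> \<Omega> - {y} \<and> z \<in> \<Omega> - {y} \<and> c x = c z}" and ?Z = "{z \<in> \<Omega> - {y}. c z = c y}"
  have eq: "{(x, z). x \<in> \<Omega> \<and> z \<in> \<Omega> \<and> c x = c z} = ?A \<union> (?Z \<times> {y} \<union> ({y} \<times> ?Z \<union> {(y, y)}))"
    using assms by auto
  have fin: "finite ?Z" "finite ?A"
    using assms(1) by (auto intro: finite_subset[of _ "\<Omega> \<times> \<Omega>"])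
  have "card ({y} \<times> ?Z \<union> {(y, y)}) = card ?Z + 1"
    using fin by (subst card_Un_disjoint) (auto simp: card_cartesian_product)
  then have "card (?Z \<times> {y} \<union> ({y} \<times> ?Z \<union> {(y, y)})) = 2 * card ?Z + 1"
    using fin by (subst card_Un_disjoint) (auto simp: card_cartesian_product)
  then show ?thesis
    unfolding eq using fin by (subst card_Un_disjoint) auto
qed

context perm_rep
begin

text \<open>Up to a factor, \<open>w\<close> is the antisymmetrization of \<open>v\<close> over
  block \<open>i\<close> enlarged by \<open>y\<close>. A new transposition of \<open>y\<close> with
  some \<open>z\<close> of the block exchanges \<open>v\<close> and
  \<open>act (transpose z y) v\<close>, which enter \<open>w\<close> with opposite signs, and
  negates the other terms.\<close>

lemma exchange_alternating:
  assumes anti: "\<And>a b. \<lbrakk>a \<in> \<Omega>; b \<in> \<Omega>; a \<noteq> b; c a = c b\<rbrakk> \<Longrightarrow> act (transpose a b) v = - v"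
    and y: "y \<in> \<Omega>" "c y \<noteq> i"
    and ab: "a \<in> \<Omega>" "b \<in> \<Omega>" "a \<noteq> b" "(c(y := i)) a = (c(y := i)) b"
  defines "w \<equiv> v - (\<Sum>x | x \<in> \<Omega> \<and> c x = i. act (transpose x y) v)"
  shows "act (transpose a b) w = - w"
proof -
  define I where "I = {x. x \<in> \<Omega> \<and> c x = i}"
  have finI: "finite I" and IO: "\<And>x. x \<in> I \<Longrightarrow> x \<in> \<Omega>" and yI: "y \<notin> I" using fin y by (auto simp: I_def)
  have w: "w = v - (\<Sum>x\<in>I. act (transpose x y) v)" by (simp add: w_def I_def)
  have act_w: "act t w = act t v - (\<Sum>x\<in>I. act t (act (transpose x y) v))" if "t permutes \<Omega>" for t
    using that unfolding w by (simp add: diff_conv_add_uminus act_add act_minus act_sum del: add_uminus_conv_diff)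
  have mixed: "act (transpose z y) w = - w" if z: "z \<in> I" for z
  proof -
    have zO: "z \<in> \<Omega>" using z IO by simp
    have t: "transpose z y permutes \<Omega>" using zO y by (simp add: permutes_swap_id)
    have "act (transpose z y) (act (transpose x y) v) = - act (transpose x y) v" if x: "x \<in> I - {z}" for x
    proof -
      have xO: "x \<in> \<Omega>" "x \<noteq> z" "x \<noteq> y" "z \<noteq> y" using x IO yI z by auto
      have s: "transpose x y permutes \<Omega>" using xO y by (simp add: permutes_swap_id)
      have "act (transpose x y) (act (transpose z x) v) = act (transpose z y) (act (transpose x y) v)"
        using act_conj[OF s zO xO(1)] xO by simp
      moreover have "act (transpose z x) v = - v" using anti[of z x] zO xO x z by (auto simp: I_def)
      ultimately show ?thesis using s by (simp add: act_minus)
    qed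
    then have "(\<Sum>x\<in>I. act (transpose z y) (act (transpose x y) v)) = v - (\<Sum>x\<in>I - {z}. act (transpose x y) v)"
      using z finI zO y by (simp add: sum.remove[of I z] act_swap_swap sum_negf)
    then have "act (transpose z y) w = act (transpose z y) v + (\<Sum>x\<in>I - {z}. act (transpose x y) v) - v"
      using act_w[OF t] by simp
    also have "\<dots> = - w" unfolding w using z finI by (simp add: sum.remove[of I z])
    finally show ?thesis .
  qed
  show ?thesis
  proof (cases "a = y \<or> b = y")
    case True
    then show ?thesis
    proof
      assume "a = y"
      then have "b \<in> I" using ab by (auto simp: I_def)
      then show ?thesis using mixed[of b] \<open>a = y\<close> by (simp add: transpose_commute)
    next
      assume "b = y"
      then have "a \<in> I" using ab by (auto simp: I_def)
      then show ?thesis using mixed[of a] \<open>b = y\<close> by simp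
    qed
  next
    case False
    then have c: "c a = c b" using ab by simp
    let ?t = "transpose a b"
    have t: "?t permutes \<Omega>" using ab by (simp add: permutes_swap_id)
    have neg: "act ?t v = - v" using anti ab c by simp
    have "bij_betw ?t I I"
      by (rule bij_betw_byWitness[where f' = ?t]) (use c ab in \<open>auto simp: I_def transpose_def\<close>)
    then have "(\<Sum>x\<in>I. act (transpose x y) v) = (\<Sum>x\<in>I. act (transpose (?t x) y) v)"
      by (rule sum.reindex_bij_betw[symmetric])
    also have "\<dots> = (\<Sum>x\<in>I. - act ?t (act (transpose x y) v))"
    proof (rule sum.cong)
      fix x assume "x \<in> I"
      then have "act ?t (act (transpose x y) v) = act (transpose (?t x) y) (- v)"
        using act_conj[OF t, of x y v] IO y False neg by simp
      moreover have "transpose (?t x) y permutes \<Omega>"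
        using \<open>x \<in> I\<close> IO y t by (simp add: permutes_swap_id permutes_in_image)
      ultimately show "act (transpose (?t x) y) v = - act ?t (act (transpose x y) v)"
        by (simp add: act_minus)
    qed simp
    finally have "(\<Sum>x\<in>I. act ?t (act (transpose x y) v)) = - (\<Sum>x\<in>I. act (transpose x y) v)"
      by (simp add: sum_negf)
    then show ?thesis using act_w[OF t] neg by (simp add: w)
  qed
qed

text \<open>A failing relation would yield, by \<open>exchange_alternating\<close>, a nonzero
  alternating vector in \<open>X\<close> for the set partition with \<open>y\<close> moved into a
  block at least as large as its own. Such a move increases the number \<open>wt\<close> of equally
  labelled ordered pairs, which is the sum of the squared block sizes.\<close>

lemma exists_extremal_alternating:
  assumes X: "subspace X" "\<And>g v. \<lbrakk>g permutes \<Omega>; v \<in> X\<rbrakk> \<Longrightarrow> act g v \<in> X"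
    and u: "u \<in> X" "u \<noteq> 0"
  shows "\<exists>v\<in>X. \<exists>c :: nat \<Rightarrow> nat. v \<noteq> 0
    \<and> (\<forall>x\<in>\<Omega>. \<forall>y\<in>\<Omega>. x \<noteq> y \<longrightarrow> c x = c y \<longrightarrow> act (transpose x y) v = - v)
    \<and> (\<forall>y\<in>\<Omega>. \<forall>i. c y \<noteq> i \<longrightarrow> card {x \<in> \<Omega>. c x = c y} \<le> card {x \<in> \<Omega>. c x = i}
          \<longrightarrow> (\<Sum>x | x \<in> \<Omega> \<and> c x = i. act (transpose x y) v) = v)"
proof -
  define good where "good c \<longleftrightarrow> (\<exists>v\<in>X. v \<noteq> 0 \<and>
    (\<forall>x\<in>\<Omega>. \<forall>y\<in>\<Omega>. x \<noteq> y \<longrightarrow> c x = c y \<longrightarrow> act (transpose x y) v = - v))" for c :: "nat \<Rightarrow> nat"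
  define wt where "wt c = card {(x, z). x \<in> \<Omega> \<and> z \<in> \<Omega> \<and> c x = c z}" for c :: "nat \<Rightarrow> nat"
  \<comment> \<open>The labels of \<open>id\<close> are distinct, so alternation is vacuous and any
    nonzero vector of \<open>X\<close> qualifies.\<close>
  have "good id" using u by (auto simp: good_def)
  moreover have "wt c < Suc (card (\<Omega> \<times> \<Omega>))" for c
    unfolding wt_def less_Suc_eq_le using fin by (intro card_mono) auto
  ultimately obtain c where c: "good c" and max: "\<And>c'. good c' \<Longrightarrow> wt c' \<le> wt c"
    using ex_has_greatest_nat[of good id wt "Suc (card (\<Omega> \<times> \<Omega>))"] by blast
  from c obtain v where v: "v \<in> X" "v \<noteq> 0"
    and anti: "\<And>x y. \<lbrakk>x \<in> \<Omega>; y \<in> \<Omega>; x \<noteq> y; c x = c y\<rbrakk> \<Longrightarrow> act (transpose x y) v = - v"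
    by (auto simp: good_def)
  show ?thesis
  proof (intro bexI[OF _ v(1)] exI[of _ c] conjI ballI allI impI)
    show "v \<noteq> 0" by (rule v(2))
    show "act (transpose x y) v = - v" if "x \<in> \<Omega>" "y \<in> \<Omega>" "x \<noteq> y" "c x = c y" for x y
      using that by (rule anti)
    show "(\<Sum>x | x \<in> \<Omega> \<and> c x = i. act (transpose x y) v) = v"
      if y: "y \<in> \<Omega>" "c y \<noteq> i" and le: "card {x \<in> \<Omega>. c x = c y} \<le> card {x \<in> \<Omega>. c x = i}" for y i
    proof (rule ccontr)
      define w where "w = v - (\<Sum>x | x \<in> \<Omega> \<and> c x = i. act (transpose x y) v)"
      assume "\<not> ?thesis"
      then have "w \<noteq> 0" by (simp add: w_def)
      moreover have "w \<in> X"
        unfolding w_def using v y X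
        by (intro subspace_diff subspace_sum) (auto intro!: X(2) permutes_swap_id)
      moreover have "act (transpose a b) w = - w"
        if "a \<in> \<Omega>" "b \<in> \<Omega>" "a \<noteq> b" "(c(y := i)) a = (c(y := i)) b" for a b
        unfolding w_def using anti y that by (rule exchange_alternating)
      ultimately have "good (c(y := i))"
        unfolding good_def by blast
      then have "wt (c(y := i)) \<le> wt c" by (rule max)
      moreover have "{(x, z). x \<in> \<Omega> - {y} \<and> z \<in> \<Omega> - {y} \<and> (c(y := i)) x = (c(y := i)) z}
          = {(x, z). x \<in> \<Omega> - {y} \<and> z \<in> \<Omega> - {y} \<and> c x = c z}" by auto
      moreover have "{z \<in> \<Omega> - {y}. (c(y := i)) z = (c(y := i)) y} = {x \<in> \<Omega>. c x = i}"
        using y by auto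
      \<comment> \<open>The two weights differ only in the number of partners of \<open>y\<close>.
        As \<open>y\<close> is not its own partner, blocks of equal size are already
        contradictory.\<close>
      ultimately have "card {x \<in> \<Omega>. c x = i} \<le> card {z \<in> \<Omega> - {y}. c z = c y}"
        unfolding wt_def card_equal_label_pairs[OF fin y(1), of c]
          card_equal_label_pairs[OF fin y(1), of "c(y := i)"] by simp
      moreover have "{z \<in> \<Omega> - {y}. c z = c y} = {z \<in> \<Omega>. c z = c y} - {y}" by auto
      moreover have "card ({z \<in> \<Omega>. c z = c y} - {y}) < card {z \<in> \<Omega>. c z = c y}"
        using y fin by (intro psubset_card_mono) auto
      ultimately show False using le by simp
    qed
  qed
qed

end

section \<open>The canonical tableau\<close>

lemma sum_list_take_Suc: "i < length lam \<Longrightarrow> sum_list (take (Suc i) lam) = sum_list (take i lam) + lam ! i"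
  for lam :: "nat list"
  by (simp add: take_Suc_conv_app_nth)

lemma sum_list_take_mono: "i \<le> j \<Longrightarrow> sum_list (take i lam) \<le> sum_list (take j lam)" for lam :: "nat list"
  by (auto simp: le_iff_add take_add)

lemma row_of_col_of_cell:
  assumes "r < length lam" "c < lam ! r"
  shows "row_of lam (sum_list (take r lam) + c) = r"
    and "col_of lam (sum_list (take r lam) + c) = c"
    and "sum_list (take r lam) + c < sum_list lam"
proof -
  let ?x = "sum_list (take r lam) + c"
  have lt: "?x < sum_list (take (Suc r) lam)" using assms by (simp add: sum_list_take_Suc)
  have "{i. 1 \<le> i \<and> i \<le> length lam \<and> sum_list (take i lam) \<le> ?x} = {1..r}"
  proof (intro set_eqI iffI)
    fix i assume i: "i \<in> {i. 1 \<le> i \<and> i \<le> length lam \<and> sum_list (take i lam) \<le> ?x}"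
    have "\<not> Suc r \<le> i" using i lt sum_list_take_mono[of "Suc r" i lam] by auto
    then show "i \<in> {1..r}" using i by simp
  next
    fix i assume i: "i \<in> {1..r}"
    then show "i \<in> {i. 1 \<le> i \<and> i \<le> length lam \<and> sum_list (take i lam) \<le> ?x}"
      using assms sum_list_take_mono[of i r lam] by auto
  qed
  then show r: "row_of lam ?x = r" by (simp add: row_of_def)
  show "col_of lam ?x = c" by (simp add: col_of_def r)
  show "?x < sum_list lam"
    using lt sum_list_take_mono[of "Suc r" "length lam" lam] assms by simp
qed

lemma cell_decomposition:
  assumes "x < sum_list lam"
  shows "row_of lam x < length lam" "col_of lam x < lam ! row_of lam x"
    "sum_list (take (row_of lam x) lam) + col_of lam x = x"
proof -
  define r where "r = (LEAST r. x < sum_list (take (Suc r) lam))"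
  have ex: "x < sum_list (take (Suc (length lam)) lam)" using assms by simp
  have r: "x < sum_list (take (Suc r) lam)" unfolding r_def using ex by (rule LeastI)
  have rl: "r < length lam"
  proof (rule ccontr)
    assume nl: "\<not> r < length lam"
    have "lam \<noteq> []" using assms by auto
    then have "x < sum_list (take (Suc (length lam - 1)) lam)" using assms by simp
    then have "r \<le> length lam - 1" unfolding r_def by (rule Least_le)
    then show False using nl \<open>lam \<noteq> []\<close> by (cases lam) auto
  qed
  have le: "sum_list (take r lam) \<le> x"
  proof (cases r)
    case (Suc r')
    then have "\<not> x < sum_list (take (Suc r') lam)"
      unfolding r_def using not_less_Least by (metis lessI)
    then show ?thesis using Suc by simp
  qed simp
  define c where "c = x - sum_list (take r lam)"
  have x: "x = sum_list (take r lam) + c" using le by (simp add: c_def)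
  have c: "c < lam ! r" using r le rl by (simp add: sum_list_take_Suc c_def)
  note * = row_of_col_of_cell[OF rl c, folded x]
  show "row_of lam x < length lam" "col_of lam x < lam ! row_of lam x"
    "sum_list (take (row_of lam x) lam) + col_of lam x = x"
    using * rl c x by simp_all
qed

lemma inj_on_col_row: "inj_on (\<lambda>x. (col_of lam x, row_of lam x)) {..<sum_list lam}"
proof (rule inj_onI)
  fix x y assume xy: "x \<in> {..<sum_list lam}" "y \<in> {..<sum_list lam}"
    "(col_of lam x, row_of lam x) = (col_of lam y, row_of lam y)"
  have "x = sum_list (take (row_of lam x) lam) + col_of lam x"
    using cell_decomposition(3)[of x lam] xy(1) by auto
  also have "\<dots> = sum_list (take (row_of lam y) lam) + col_of lam y"
    using xy(3) by auto
  also have "\<dots> = y" using cell_decomposition(3)[of y lam] xy(2) by auto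
  finally show "x = y" .
qed

lemma is_partition_nth_mono: "\<lbrakk>is_partition lam; i \<le> j; j < length lam\<rbrakk> \<Longrightarrow> lam ! j \<le> lam ! i"
  unfolding is_partition_def sorted_wrt_iff_nth_less by (cases "i = j") simp_all

lemma diagram_down_closed:
  assumes "is_partition lam" "x \<in> {..<sum_list lam}" "i \<le> col_of lam x" "j \<le> row_of lam x"
  shows "\<exists>z\<in>{..<sum_list lam}. col_of lam z = i \<and> row_of lam z = j"
proof -
  note cd = cell_decomposition[of x lam]
  have j: "j < length lam" using assms cd by simp
  moreover have "i < lam ! j"
    using is_partition_nth_mono[OF assms(1,4)] assms cd by simp
  ultimately show ?thesis using row_of_col_of_cell[of j lam i] by auto
qed

lemma card_row: "card {x \<in> {..<sum_list lam}. row_of lam x = i} = part lam (Suc i)"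
proof (cases "i < length lam")
  case True
  have "bij_betw (\<lambda>c. sum_list (take i lam) + c) {..<lam ! i} {x \<in> {..<sum_list lam}. row_of lam x = i}"
    by (rule bij_betw_byWitness[where f' = "col_of lam"])
       (use True row_of_col_of_cell[of i lam] cell_decomposition[of _ lam] in auto)
  from bij_betw_same_card[OF this] show ?thesis using True by (simp add: part_def)
next
  case False
  then have "{x \<in> {..<sum_list lam}. row_of lam x = i} = {}" using cell_decomposition(1) by force
  then show ?thesis using False by (simp add: part_def)
qed

lemma card_col: "card {x \<in> {..<sum_list lam}. col_of lam x = j} = card {i. i < length lam \<and> j < lam ! i}"
proof -
  have "bij_betw (\<lambda>i. sum_list (take i lam) + j) {i. i < length lam \<and> j < lam ! i}
      {x \<in> {..<sum_list lam}. col_of lam x = j}"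
    by (rule bij_betw_byWitness[where f' = "row_of lam"])
       (use row_of_col_of_cell[of _ lam j] cell_decomposition[of _ lam] in auto)
  from bij_betw_same_card[OF this] show ?thesis by simp
qed

section \<open>Diagrams whose columns realize a given set partition\<close>

lemma exists_permutation_matching_labels:
  assumes "finite \<Omega>" "inj_on e (f ` \<Omega>)"
    and "\<And>l. l \<in> f ` \<Omega> \<Longrightarrow> card {x \<in> \<Omega>. f x = l} = card {x \<in> \<Omega>. g x = e l}"
  obtains h where "h permutes \<Omega>" "\<And>x. x \<in> \<Omega> \<Longrightarrow> g (h x) = e (f x)"
proof -
  have "\<forall>l\<in>f ` \<Omega>. \<exists>b. bij_betw b {x \<in> \<Omega>. f x = l} {x \<in> \<Omega>. g x = e l}"
  proof
    fix l assume "l \<in> f ` \<Omega>"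
    from assms(3)[OF this] show "\<exists>b. bij_betw b {x \<in> \<Omega>. f x = l} {x \<in> \<Omega>. g x = e l}"
      using assms(1) by (intro finite_same_card_bij) simp_all
  qed
  then obtain b where b: "\<And>l. l \<in> f ` \<Omega> \<Longrightarrow> bij_betw (b l) {x \<in> \<Omega>. f x = l} {x \<in> \<Omega>. g x = e l}"
    by metis
  define h where "h x = (if x \<in> \<Omega> then b (f x) x else x)" for x
  have h: "h x \<in> \<Omega>" "g (h x) = e (f x)" if "x \<in> \<Omega>" for x
    using that bij_betwE[OF b[of "f x"]] by (auto simp: h_def)
  have "inj_on h \<Omega>"
  proof (rule inj_onI)
    fix x y assume xy: "x \<in> \<Omega>" "y \<in> \<Omega>" "h x = h y"
    then have "f x = f y" using h assms(2) by (metis imageI inj_onD)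
    then show "x = y" using xy bij_betw_imp_inj_on[OF b[of "f x"]] by (auto simp: h_def inj_on_def)
  qed
  then have "bij_betw h \<Omega> \<Omega>"
    using h assms(1) endo_inj_surj[of \<Omega> h] by (auto simp: bij_betw_def)
  then have "h permutes \<Omega>" by (rule bij_imp_permutes) (simp add: h_def)
  then show thesis using h that by blast
qed

lemma down_closed_eq_lessThan:
  fixes A :: "nat set"
  assumes "finite A" "\<And>i j. \<lbrakk>j \<in> A; i \<le> j\<rbrakk> \<Longrightarrow> i \<in> A"
  shows "A = {..<card A}"
proof -
  define n where "n = (LEAST n. n \<notin> A)"
  have "\<exists>n. n \<notin> A" using assms(1) infinite_UNIV_nat by (metis UNIV_eq_I)
  then have "n \<notin> A" unfolding n_def by (rule LeastI_ex)
  moreover have "i \<in> A" if "i < n" for i using that not_less_Least unfolding n_def by blast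
  ultimately have "A = {..<n}" using assms(2) by (metis lessThan_iff linorder_not_less set_eq_iff)
  then show ?thesis by simp
qed

text \<open>Labels sorted by decreasing fibre size become the columns, so \<open>lam\<close> is the
  conjugate of the sorted list of sizes; bijections from fibres to columns of equal size glue to
  \<open>h\<close>. The names of the labels are lost, only the set partition survives.\<close>

lemma exists_partition_with_columns:
  fixes c :: "nat \<Rightarrow> nat"
  obtains lam h where "is_partition lam" "sum_list lam = m" "h permutes {..<m}"
    "\<forall>x<m. \<forall>y<m. c x = c y \<longleftrightarrow> col_of lam (h x) = col_of lam (h y)"
proof -
  define N where "N l = card {x \<in> {..<m}. c x = l}" for l
  define ls where "ls = rev (sort_key N (sorted_list_of_set (c ` {..<m})))"
  have set_ls: "set ls = c ` {..<m}" and dist: "distinct ls" by (simp_all add: ls_def)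
  have srt: "N (ls ! j) \<le> N (ls ! i)" if "i \<le> j" "j < length ls" for i j
  proof -
    have "sorted (rev (map N ls))" by (simp add: ls_def rev_map)
    then show ?thesis using that sorted_rev_nth_mono[of "map N ls" i j] by simp
  qed
  define s where "s j = N (ls ! j)" for j
  define L where "L = length ls"
  \<comment> \<open>The number of rows is the largest fibre size; without any points
    \<open>ls\<close> has no first entry, hence the case distinction.\<close>
  define K where "K = (if L = 0 then 0 else s 0)"
  define lam where "lam = map (\<lambda>i. card {j. j < L \<and> i < s j}) [0..<K]"
  have len: "length lam = K" by (simp add: lam_def)
  have sK: "s j \<le> K" if "j < L" for j using srt[of 0 j] that by (auto simp: K_def s_def L_def)
  have nth: "j < lam ! i \<longleftrightarrow> j < L \<and> i < s j" if "i < K" for i j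
  proof -
    have "{j. j < L \<and> i < s j} = {..<card {j. j < L \<and> i < s j}}"
    proof (rule down_closed_eq_lessThan)
      fix i' j' assume *: "j' \<in> {j. j < L \<and> i < s j}" "i' \<le> j'"
      then have "s j' \<le> s i'" using srt[of i' j'] by (simp add: s_def L_def)
      then show "i' \<in> {j. j < L \<and> i < s j}" using * by simp
    qed simp
    then have "j \<in> {j. j < L \<and> i < s j} \<longleftrightarrow> j \<in> {..<card {j. j < L \<and> i < s j}}"
      by (rule arg_cong)
    then show ?thesis using that by (simp add: lam_def)
  qed
  have cardK: "card {i. i < K \<and> i < s j} = s j" if "j < L" for j
  proof -
    have "{i. i < K \<and> i < s j} = {..<s j}" using sK[OF that] by auto
    then show ?thesis by simp
  qed
  have part: "is_partition lam"
  proof -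
    have "lam ! j \<le> lam ! i" if "i < j" "j < K" for i j
      using that by (auto simp: lam_def intro!: card_mono)
    moreover have "0 < lam ! i" if "i < K" for i
      using nth[OF that, of 0] that by (auto simp: K_def split: if_splits)
    ultimately show ?thesis
      by (auto simp: is_partition_def sorted_wrt_iff_nth_less len in_set_conv_nth)
  qed
  have sum: "sum_list lam = m"
  proof -
    have "sum_list lam = (\<Sum>i<K. card {j. j < L \<and> i < s j})"
      by (simp add: lam_def interv_sum_list_conv_sum_set_nat atLeast0LessThan)
    also have "\<dots> = (\<Sum>i<K. \<Sum>j<L. if i < s j then 1 else 0)"
      by (intro sum.cong refl) (auto simp: sum.If_cases intro!: arg_cong[where f = card])
    also have "\<dots> = (\<Sum>j<L. \<Sum>i<K. if i < s j then 1 else 0)" by (rule sum.swap)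
    also have "\<dots> = (\<Sum>j<L. card {i. i < K \<and> i < s j})"
      by (intro sum.cong refl) (auto simp: sum.If_cases intro!: arg_cong[where f = card])
    also have "\<dots> = (\<Sum>j<L. N (ls ! j))" using cardK by (simp add: s_def)
    also have "\<dots> = (\<Sum>l\<in>set ls. N l)"
      using sum.reindex_bij_betw[OF bij_betw_nth[OF dist refl refl], of N] by (simp add: L_def)
    also have "\<dots> = (\<Sum>x<m. 1)"
      unfolding set_ls N_def card_eq_sum by (rule sum.image_gen[symmetric]) simp
    finally show ?thesis by simp
  qed
  define e where "e = the_inv_into {..<L} (\<lambda>j. ls ! j)"
  have bij: "bij_betw (\<lambda>j. ls ! j) {..<L} (c ` {..<m})"
    using bij_betw_nth[OF dist refl refl] by (simp add: L_def set_ls)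
  have bije: "bij_betw e (c ` {..<m}) {..<L}" unfolding e_def using bij by (rule bij_betw_the_inv_into)
  have lse: "ls ! e l = l" if "l \<in> c ` {..<m}" for l
    unfolding e_def using that bij by (intro f_the_inv_into_f_bij_betw) auto
  have fibers: "card {x \<in> {..<m}. c x = l} = card {x \<in> {..<m}. col_of lam x = e l}" if "l \<in> c ` {..<m}" for l
  proof -
    have eL: "e l < L" using bij_betwE[OF bije] that by auto
    have "card {x \<in> {..<m}. col_of lam x = e l} = card {i. i < K \<and> e l < lam ! i}"
      using card_col[of lam "e l"] by (simp add: sum len)
    also have "{i. i < K \<and> e l < lam ! i} = {i. i < K \<and> i < s (e l)}" using nth eL by auto
    also have "card \<dots> = N l" using cardK[OF eL] lse[OF that] by (simp add: s_def)
    finally show ?thesis by (simp add: N_def)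
  qed
  obtain h where h: "h permutes {..<m}" "\<And>x. x \<in> {..<m} \<Longrightarrow> col_of lam (h x) = e (c x)"
    using exists_permutation_matching_labels[of "{..<m}" e c "col_of lam"]
      bij_betw_imp_inj_on[OF bije] fibers by auto
  show thesis
  proof (rule that[OF part sum h(1)], intro allI impI)
    fix x y assume "x < m" "y < m"
    then show "c x = c y \<longleftrightarrow> col_of lam (h x) = col_of lam (h y)"
      using h(2) bij_betw_imp_inj_on[OF bije] by (auto simp: inj_on_def)
  qed
qed

section \<open>Specht modules, Schur modules and their homomorphisms\<close>

lemma fun_sum_apply: "(sum F I) x = (\<Sum>i\<in>I. F i x)"
  by (induction I rule: infinite_finite_induct) simp_all

context perm_rep
begin

lemma stab_alt_add: "stab_alt f (u + v) = stab_alt f u + stab_alt f v"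
  unfolding stab_alt_eq_twist by (rule perm_rep.stab_sum_add[OF sign_twist])

lemma stab_alt_scale: "stab_alt f (c *s v) = c *s stab_alt f v"
  unfolding stab_alt_eq_twist by (rule perm_rep.stab_sum_scale[OF sign_twist])

lemma stab_alt_zero: "stab_alt f 0 = 0"
  unfolding stab_alt_eq_twist by (rule perm_rep.stab_sum_zero[OF sign_twist])

lemma act_swap_stab_sum:
  assumes "x \<in> \<Omega>" "y \<in> \<Omega>" "f x = f y"
  shows "act (transpose x y) (stab_sum f v) = stab_sum f v"
  using transpose_in_label_stabilizer[OF assms] by (rule act_stab_sum)

context
  fixes F :: "'v \<Rightarrow> 'v"
  assumes F_add: "\<And>u v. F (u + v) = F u + F v"
    and F_scale: "\<And>c v. F (c *s v) = c *s F v"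
    and F_act: "\<And>g v. g permutes \<Omega> \<Longrightarrow> F (act g v) = act g (F v)"
begin

lemma F_sum: "F (sum h I) = (\<Sum>i\<in>I. F (h i))"
  using F_add[of 0 0] by (induction I rule: infinite_finite_induct) (simp_all add: F_add)

lemma stab_sum_commute: "F (stab_sum f v) = stab_sum f (F v)"
  unfolding stab_sum_def F_sum by (intro sum.cong refl F_act) (rule label_stabilizerD(1))

lemma stab_alt_commute: "F (stab_alt f v) = stab_alt f (F v)"
  unfolding stab_alt_def F_sum F_scale using F_act label_stabilizerD(1) by (intro sum.cong refl) simp

lemma sym_sum_commute: "S \<subseteq> \<Omega> \<Longrightarrow> F (sym_sum S v) = sym_sum S (F v)"
  unfolding sym_sum_def F_sum by (intro sum.cong refl F_act) (auto dest: permutes_subset)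

end

end

section \<open>The place and letter actions on tensors, and Schur modules\<close>

definition fscale :: "complex \<Rightarrow> ('a \<Rightarrow> complex) \<Rightarrow> ('a \<Rightarrow> complex)" where
  "fscale c v = (\<lambda>x. c * v x)"

lemma fscale_apply [simp]: "fscale c v x = c * v x"
  by (simp add: fscale_def)

interpretation fun_space: vector_space fscale
  by unfold_locales (simp_all add: fun_eq_iff algebra_simps)

lemma permutes_inv_comp:
  assumes "g permutes \<Omega>" "h permutes \<Omega>"
  shows "inv (g \<circ> h) = inv h \<circ> inv g"
  using assms by (simp add: o_inv_distrib permutes_bij)

lemma perm_rep_specht: "perm_rep fscale {..<n} specht_act"
  by unfold_locales (auto simp: specht_act_def permutes_inv_comp fun_eq_iff o_assoc)

lemma perm_rep_tensor: "perm_rep fscale {..<n} tensor_act"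
  by unfold_locales (auto simp: tensor_act_def permutes_inv_comp fun_eq_iff)

text \<open>Unlike \<^const>\<open>pos_act\<close>, this is an action on all functions; on words of the wrong length it is trivial.\<close>

definition place_act :: "nat \<Rightarrow> (nat \<Rightarrow> nat) \<Rightarrow> (nat list \<Rightarrow> complex) \<Rightarrow> (nat list \<Rightarrow> complex)" where
  "place_act m p T = (\<lambda>w. if length w = m then T (permute_list p w) else T w)"

lemma perm_rep_place: "perm_rep fscale {..<m} (place_act m)"
  by unfold_locales (auto simp: place_act_def permute_list_compose fun_eq_iff)

lemma place_act_tensor_space:
  assumes "p permutes {..<m}" "T \<in> tensor_space n m"
  shows "place_act m p T \<in> tensor_space n m"
proof -
  have T: "length w = m \<and> set w \<subseteq> {..<n}" if "T w \<noteq> 0" for w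
    using assms(2) that by (simp add: tensor_space_def)
  have "length w = m \<and> set w \<subseteq> {..<n}" if "place_act m p T w \<noteq> 0" for w
  proof (cases "length w = m")
    case True
    then show ?thesis
      using T[of "permute_list p w"] that assms(1) set_permute_list[of p w] by (simp add: place_act_def)
  next
    case False
    then show ?thesis using T[of w] that by (simp add: place_act_def)
  qed
  then show ?thesis by (simp add: tensor_space_def)
qed

lemma tensor_act_tensor_space:
  assumes "s permutes {..<n}" "T \<in> tensor_space n m"
  shows "tensor_act s T \<in> tensor_space n m"
proof -
  have "length w = m \<and> set w \<subseteq> {..<n}" if "T (map (inv s) w) \<noteq> 0" for w
  proof -
    have "length (map (inv s) w) = m" "set (map (inv s) w) \<subseteq> {..<n}"
      using assms(2) that unfolding tensor_space_def by blast+
    then show ?thesis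
      using permutes_in_image[OF permutes_inv[OF assms(1)]] by (auto simp: image_subset_iff)
  qed
  then show ?thesis by (simp add: tensor_space_def tensor_act_def)
qed

lemma subspace_tensor_space: "fun_space.subspace (tensor_space n m)"
proof (rule fun_space.subspaceI)
  fix x y :: "nat list \<Rightarrow> complex" assume xy: "x \<in> tensor_space n m" "y \<in> tensor_space n m"
  have "length w = m \<and> set w \<subseteq> {..<n}" if "x w + y w \<noteq> 0" for w
  proof -
    have "x w \<noteq> 0 \<or> y w \<noteq> 0" using that by auto
    then show ?thesis using xy by (auto simp: tensor_space_def)
  qed
  then show "x + y \<in> tensor_space n m" by (simp add: tensor_space_def)
qed (auto simp: tensor_space_def)

lemma tensor_act_add: "tensor_act s (u + v) = tensor_act s u + tensor_act s v"
  and tensor_act_fscale: "tensor_act s (fscale c v) = fscale c (tensor_act s v)"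
  by (auto simp: tensor_act_def fun_eq_iff)

lemma tensor_act_place_act:
  "p permutes {..<m} \<Longrightarrow> tensor_act s (place_act m p T) = place_act m p (tensor_act s T)"
  by (auto simp: tensor_act_def place_act_def fun_eq_iff permute_list_map)

abbreviation place_sum :: "nat list \<Rightarrow> (nat list \<Rightarrow> complex) \<Rightarrow> (nat list \<Rightarrow> complex)" where
  "place_sum lam \<equiv> perm_rep.stab_sum {..<sum_list lam} (place_act (sum_list lam)) (row_of lam)"

abbreviation place_alt :: "nat list \<Rightarrow> (nat list \<Rightarrow> complex) \<Rightarrow> (nat list \<Rightarrow> complex)" where
  "place_alt lam \<equiv> perm_rep.stab_alt fscale {..<sum_list lam} (place_act (sum_list lam)) (col_of lam)"

abbreviation letter_sum :: "nat list \<Rightarrow> (nat list \<Rightarrow> complex) \<Rightarrow> (nat list \<Rightarrow> complex)" where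
  "letter_sum mu \<equiv> perm_rep.stab_sum {..<sum_list mu} tensor_act (row_of mu)"

abbreviation letter_alt :: "nat list \<Rightarrow> (nat list \<Rightarrow> complex) \<Rightarrow> (nat list \<Rightarrow> complex)" where
  "letter_alt mu \<equiv> perm_rep.stab_alt fscale {..<sum_list mu} tensor_act (col_of mu)"

lemma row_group_eq: "row_group lam = label_stabilizer {..<sum_list lam} (row_of lam)"
  by (auto simp: row_group_def label_stabilizer_def)

lemma col_group_eq: "col_group lam = label_stabilizer {..<sum_list lam} (col_of lam)"
  by (auto simp: col_group_def label_stabilizer_def)

lemma place_alt_tensor_space:
  assumes "T \<in> tensor_space n (sum_list lam)"
  shows "place_alt lam T \<in> tensor_space n (sum_list lam)"
proof -
  interpret pos: perm_rep fscale "{..<sum_list lam}" "place_act (sum_list lam)" by (rule perm_rep_place)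
  show ?thesis
    unfolding pos.stab_alt_def using assms
    by (intro fun_space.subspace_sum fun_space.subspace_scale subspace_tensor_space place_act_tensor_space)
       (auto intro: label_stabilizerD)
qed

lemma place_sum_tensor_space:
  assumes "T \<in> tensor_space n (sum_list lam)"
  shows "place_sum lam T \<in> tensor_space n (sum_list lam)"
proof -
  interpret pos: perm_rep fscale "{..<sum_list lam}" "place_act (sum_list lam)" by (rule perm_rep_place)
  show ?thesis
    unfolding pos.stab_sum_def using assms
    by (intro fun_space.subspace_sum subspace_tensor_space place_act_tensor_space)
       (auto intro: label_stabilizerD)
qed

lemma young_sym_tensor_eq:
  assumes "T \<in> tensor_space n (sum_list lam)"
  shows "young_sym_tensor lam T = place_sum lam (place_alt lam T)"
proof -
  let ?m = "sum_list lam"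
  interpret pos: perm_rep fscale "{..<?m}" "place_act ?m" by (rule perm_rep_place)
  have eq: "pos_act p U = place_act ?m p U" if "U \<in> tensor_space n ?m" for p U
  proof
    fix w
    have "U w' = 0" if "length w' \<noteq> ?m" for w' using \<open>U \<in> _\<close> that by (auto simp: tensor_space_def)
    then show "pos_act p U w = place_act ?m p U w" by (auto simp: pos_act_def place_act_def)
  qed
  have "(\<lambda>u. \<Sum>q\<in>col_group lam. of_int (sign q) * pos_act q T u) = place_alt lam T"
    by (simp add: fun_eq_iff pos.stab_alt_def col_group_eq fun_sum_apply eq[OF assms])
  then show ?thesis
    unfolding young_sym_tensor_def pos.stab_sum_def
    using eq[OF place_alt_tensor_space[OF assms]]
    by (simp add: fun_eq_iff fun_sum_apply row_group_eq)
qed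

lemma schur_module_eq:
  "schur_module lam n = (\<lambda>T. place_sum lam (place_alt lam T)) ` tensor_space n (sum_list lam)"
  unfolding schur_module_def by (intro image_cong refl young_sym_tensor_eq)

lemma schur_module_subset: "schur_module lam n \<subseteq> tensor_space n (sum_list lam)"
  unfolding schur_module_eq by (auto intro: place_sum_tensor_space place_alt_tensor_space)

lemma subspace_schur_module: "fun_space.subspace (schur_module lam n)"
proof -
  interpret pos: perm_rep fscale "{..<sum_list lam}" "place_act (sum_list lam)" by (rule perm_rep_place)
  show ?thesis
  proof (rule fun_space.subspaceI)
    show "0 \<in> schur_module lam n"
      unfolding schur_module_eq using fun_space.subspace_0[OF subspace_tensor_space]
      by (rule rev_image_eqI) (simp add: pos.stab_alt_zero pos.stab_sum_zero)
    show "x + y \<in> schur_module lam n" if "x \<in> schur_module lam n" "y \<in> schur_module lam n" for x y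
      using that fun_space.subspace_add[OF subspace_tensor_space] unfolding schur_module_eq
      by (auto simp: pos.stab_alt_add[symmetric] pos.stab_sum_add[symmetric])
    show "fscale c x \<in> schur_module lam n" if "x \<in> schur_module lam n" for c x
      using that fun_space.subspace_scale[OF subspace_tensor_space] unfolding schur_module_eq
      by (auto simp: pos.stab_alt_scale[symmetric] pos.stab_sum_scale[symmetric])
  qed
qed

lemma tensor_act_place_sum: "tensor_act s (place_sum lam T) = place_sum lam (tensor_act s T)"
proof -
  interpret pos: perm_rep fscale "{..<sum_list lam}" "place_act (sum_list lam)" by (rule perm_rep_place)
  show ?thesis
    by (rule pos.stab_sum_commute) (simp_all only: tensor_act_add tensor_act_fscale tensor_act_place_act)
qed

lemma tensor_act_place_alt: "tensor_act s (place_alt lam T) = place_alt lam (tensor_act s T)"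
proof -
  interpret pos: perm_rep fscale "{..<sum_list lam}" "place_act (sum_list lam)" by (rule perm_rep_place)
  show ?thesis
    by (rule pos.stab_alt_commute) (simp_all only: tensor_act_add tensor_act_fscale tensor_act_place_act)
qed

lemma tensor_act_schur_module:
  assumes "s permutes {..<n}" "T \<in> schur_module lam n"
  shows "tensor_act s T \<in> schur_module lam n"
  using assms unfolding schur_module_eq
  by (auto simp: tensor_act_place_sum tensor_act_place_alt intro: tensor_act_tensor_space)

section \<open>The Specht module as a cyclic module, and its homomorphisms\<close>

lemma finite_Sym: "finite (Sym n)"
  by (simp add: Sym_def finite_permutations)

lemma conv_eq_sum: "conv n x y = (\<Sum>h\<in>Sym n. fscale (x h) (specht_act h y))"
  by (simp add: conv_def fun_eq_iff fun_sum_apply specht_act_def)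

text \<open>In the left regular representation the Young symmetrizer becomes the row symmetrization
  of a column-alternating vector, as the elements of Schur modules are for the place action. The
  general facts on such vectors thus serve both.\<close>

lemma young_sym_alg_eq:
  "young_sym_alg mu = perm_rep.stab_sum {..<sum_list mu} specht_act (row_of mu)
     (perm_rep.stab_alt fscale {..<sum_list mu} specht_act (col_of mu) (delta id))"
proof -
  let ?n = "sum_list mu"
  interpret grp: perm_rep fscale "{..<?n}" specht_act by (rule perm_rep_specht)
  have delta: "delta q = specht_act q (delta id)" if "q permutes {..<?n}" for q
  proof (rule ext)
    fix g
    have "inv q \<circ> g = id \<longleftrightarrow> g = q"
      using permutes_inv_o[OF that] by (metis comp_id fun.map_comp id_comp)
    then show "delta q g = specht_act q (delta id) g" by (simp add: delta_def specht_act_def)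
  qed
  have alt: "(\<lambda>g. \<Sum>q\<in>col_group mu. of_int (sign q) * delta q g) = grp.stab_alt (col_of mu) (delta id)"
    unfolding grp.stab_alt_def col_group_eq fun_sum_apply fscale_apply fun_eq_iff
    by (intro allI sum.cong refl arg_cong2[where f = "(*)"]) (metis delta label_stabilizerD(1))
  have sub: "row_group mu \<subseteq> Sym ?n" by (auto simp: row_group_def Sym_def)
  have ind: "(\<Sum>p\<in>row_group mu. delta p h) = (if h \<in> row_group mu then 1 else 0)" for h
    using finite_subset[OF sub finite_Sym] by (simp add: delta_def)
  have "young_sym_alg mu = (\<Sum>h\<in>Sym ?n. fscale (if h \<in> row_group mu then 1 else 0)
      (specht_act h (grp.stab_alt (col_of mu) (delta id))))"
    unfolding young_sym_alg_def conv_eq_sum alt ind ..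
  also have "\<dots> = (\<Sum>h\<in>row_group mu. specht_act h (grp.stab_alt (col_of mu) (delta id)))"
    by (rule sum.mono_neutral_cong_right[OF finite_Sym sub]) (auto simp: fun_eq_iff)
  finally show ?thesis unfolding grp.stab_sum_def row_group_eq .
qed

text \<open>Arbitrary sets \<open>H\<close> of translates allow induction over the summands, and
  cover single translates as well as the sums occurring in Garnir relations.\<close>

lemma specht_partial_sum:
  assumes "H \<subseteq> Sym (sum_list mu)"
  shows "(\<Sum>h\<in>H. fscale (x h) (specht_act h (young_sym_alg mu))) \<in> specht mu"
proof -
  have "(\<Sum>h\<in>H. fscale (x h) (specht_act h (young_sym_alg mu)))
      = conv (sum_list mu) (\<lambda>h. if h \<in> H then x h else 0) (young_sym_alg mu)"
    unfolding conv_eq_sum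
    by (rule sum.mono_neutral_cong_left[OF finite_Sym assms]) (auto simp: fun_eq_iff)
  moreover have "(\<lambda>h. if h \<in> H then x h else 0) \<in> group_alg (sum_list mu)"
    using assms by (auto simp: group_alg_def)
  ultimately show ?thesis by (auto simp: specht_def)
qed

lemma id_in_Sym: "id \<in> Sym n"
  by (simp add: Sym_def permutes_id)

lemma specht_act_young_sym_alg: "h \<in> Sym (sum_list mu) \<Longrightarrow> specht_act h (young_sym_alg mu) \<in> specht mu"
  using specht_partial_sum[of "{h}" mu "\<lambda>_. 1"] by simp

lemma young_sym_alg_in_specht: "young_sym_alg mu \<in> specht mu"
  using specht_act_young_sym_alg[OF id_in_Sym] by (simp add: specht_act_def)

context
  fixes mu lam :: "nat list" and f
  assumes f: "f \<in> equiv_hom (Sym (sum_list mu)) (specht mu) specht_act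
                    (schur_module lam (sum_list mu)) tensor_act"
begin

lemma equiv_hom_lin: "\<lbrakk>u \<in> specht mu; v \<in> specht mu\<rbrakk> \<Longrightarrow> f (fscale c u + v) = fscale c (f u) + f v"
  using f by (simp add: equiv_hom_def fscale_def plus_fun_def)

lemma equiv_hom_act: "\<lbrakk>g \<in> Sym (sum_list mu); v \<in> specht mu\<rbrakk> \<Longrightarrow> f (specht_act g v) = tensor_act g (f v)"
  using f by (simp add: equiv_hom_def)

lemma equiv_hom_sum:
  assumes "H \<subseteq> Sym (sum_list mu)"
  shows "f (\<Sum>h\<in>H. fscale (x h) (specht_act h (young_sym_alg mu)))
       = (\<Sum>h\<in>H. fscale (x h) (tensor_act h (f (young_sym_alg mu))))"
  using finite_subset[OF assms finite_Sym] assms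
proof (induction H rule: finite_induct)
  case empty
  have "0 \<in> specht mu" using specht_partial_sum[of "{}" mu] by simp
  then have "f (fscale 1 0 + 0) = fscale 1 (f 0) + f 0" by (intro equiv_hom_lin)
  then have "f 0 = f 0 + f 0" by (simp only: fun_space.scale_zero_right fun_space.scale_one add_0_left)
  then have "f 0 = 0" by (metis add.right_neutral add_left_cancel)
  then show ?case by (simp only: sum.empty)
next
  case (insert h H)
  then have h: "h \<in> Sym (sum_list mu)" and H: "H \<subseteq> Sym (sum_list mu)" by auto
  show ?case
    unfolding sum.insert[OF insert.hyps]
    by (simp only: equiv_hom_lin[OF specht_act_young_sym_alg[OF h] specht_partial_sum[OF H]]
        insert.IH[OF H] equiv_hom_act[OF h young_sym_alg_in_specht])
qed

text \<open>The Young symmetrizer generates the Specht module, and outside the module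
  \<open>equiv_hom\<close> prescribes the value zero.\<close>

lemma equiv_hom_eq_0:
  assumes "f (young_sym_alg mu) = 0"
  shows "f = 0"
proof
  fix v
  show "f v = 0 v"
  proof (cases "v \<in> specht mu")
    case True
    then obtain x where "v = conv (sum_list mu) x (young_sym_alg mu)" by (auto simp: specht_def)
    then have "f v = (\<Sum>h\<in>Sym (sum_list mu). fscale (x h) (tensor_act h 0))"
      using equiv_hom_sum[OF order_refl] assms by (simp add: conv_eq_sum)
    also have "\<dots> = 0" by (intro sum.neutral) (simp add: fun_eq_iff tensor_act_def)
    finally show ?thesis by simp
  next
    case False
    then show ?thesis using f by (simp add: equiv_hom_def zero_fun_def)
  qed
qed

end

interpretation hom_space: vector_space
  "\<lambda>(c::complex) (F :: ('a \<Rightarrow> complex) \<Rightarrow> ('b \<Rightarrow> complex)). \<lambda>v y. c * F v y"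
  by unfold_locales (simp_all add: fun_eq_iff algebra_simps)

lemma tensor_space_subset_span:
  "tensor_space n m \<subseteq> fun_space.span ((\<lambda>w u. if u = w then 1 else 0) ` {w. set w \<subseteq> {..<n} \<and> length w = m})"
proof
  fix T assume T: "T \<in> tensor_space n m"
  let ?A = "{w. set w \<subseteq> {..<n} \<and> length w = m}"
  have fin: "finite ?A" by (simp add: finite_lists_length_eq)
  have "T = (\<Sum>w\<in>?A. fscale (T w) (\<lambda>u. if u = w then 1 else 0))"
  proof
    fix u
    have "(\<Sum>w\<in>?A. T w * (if u = w then 1 else 0)) = (\<Sum>w\<in>?A. if u = w then T w else 0)"
      by (intro sum.cong) auto
    also have "\<dots> = T u" using fin T by (auto simp: tensor_space_def)
    finally show "T u = (\<Sum>w\<in>?A. fscale (T w) (\<lambda>u. if u = w then 1 else 0)) u"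
      by (simp add: fun_sum_apply)
  qed
  also have "\<dots> \<in> fun_space.span ((\<lambda>w u. if u = w then 1 else 0) ` ?A)"
    by (intro fun_space.span_sum fun_space.span_scale fun_space.span_base) auto
  finally show "T \<in> fun_space.span ((\<lambda>w u. if u = w then 1 else 0) ` ?A)" .
qed

text \<open>The dimension is the \<open>card\<close> of a basis, which would be 0 for an infinite
  one. Finiteness holds because evaluation at the Young symmetrizer is injective on homomorphisms
  and takes values in a finite-dimensional tensor space.\<close>

lemma r_mult_pos_iff:
  "r_mult lam mu > 0 \<longleftrightarrow> (\<exists>f\<in>equiv_hom (Sym (sum_list mu)) (specht mu) specht_act
      (schur_module lam (sum_list mu)) tensor_act. f \<noteq> 0)"
proof -
  let ?n = "sum_list mu" and ?c = "young_sym_alg mu"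
  let ?W = "schur_module lam ?n"
  define H where "H = equiv_hom (Sym ?n) (specht mu) specht_act ?W tensor_act"
  note W = subspace_schur_module[of lam ?n]
  have subH: "hom_space.subspace H"
  proof (rule hom_space.subspaceI)
    show "0 \<in> H"
      using fun_space.subspace_0[OF W] by (simp add: H_def equiv_hom_def zero_fun_def tensor_act_def)
    show "F + G \<in> H" if FG: "F \<in> H" "G \<in> H" for F G
      unfolding H_def equiv_hom_def
    proof (intro CollectI conjI ballI allI impI)
      note F = FG[unfolded H_def equiv_hom_def mem_Collect_eq]
      show "(F + G) v \<in> ?W" if "v \<in> specht mu" for v
        using F that fun_space.subspace_add[OF W] by simp
      show "(F + G) (\<lambda>x. c * u x + v x) = (\<lambda>y. c * (F + G) u y + (F + G) v y)"
        if "u \<in> specht mu" "v \<in> specht mu" for c u v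
        using F that by (simp add: fun_eq_iff algebra_simps)
      show "(F + G) (specht_act g v) = tensor_act g ((F + G) v)" if "g \<in> Sym ?n" "v \<in> specht mu" for g v
        using F that by (simp only: plus_fun_apply tensor_act_add)
      show "(F + G) v = (\<lambda>_. 0)" if "v \<notin> specht mu" for v
        using F that by (simp add: fun_eq_iff)
    qed
    show "(\<lambda>v y. a * F v y) \<in> H" if FH: "F \<in> H" for a F
      unfolding H_def equiv_hom_def
    proof (intro CollectI conjI ballI allI impI)
      note F = FH[unfolded H_def equiv_hom_def mem_Collect_eq]
      show "(\<lambda>y. a * F v y) \<in> ?W" if "v \<in> specht mu" for v
        using F that fun_space.subspace_scale[OF W, of "F v" a] by (simp add: fscale_def)
      show "(\<lambda>y. a * F (\<lambda>x. c * u x + v x) y) = (\<lambda>y. c * (a * F u y) + a * F v y)"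
        if "u \<in> specht mu" "v \<in> specht mu" for c u v
        using F that by (simp add: fun_eq_iff algebra_simps)
      show "(\<lambda>y. a * F (specht_act g v) y) = tensor_act g (\<lambda>y. a * F v y)" if "g \<in> Sym ?n" "v \<in> specht mu" for g v
        using F that by (simp add: tensor_act_def)
      show "(\<lambda>y. a * F v y) = (\<lambda>_. 0)" if "v \<notin> specht mu" for v
        using F that by (simp add: fun_eq_iff)
    qed
  qed
  obtain B where B: "B \<subseteq> H" "hom_space.independent B" "H \<subseteq> hom_space.span B" "card B = hom_space.dim H"
    by (rule hom_space.basis_exists)
  have r: "r_mult lam mu = card B" by (simp add: r_mult_def hom_dim_def H_def[symmetric] B(4))
  have "finite B"
  proof -
    define ev where "ev F = F ?c" for F :: "((nat \<Rightarrow> nat) \<Rightarrow> complex) \<Rightarrow> nat list \<Rightarrow> complex"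
    interpret pair: vector_space_pair
      "\<lambda>(c::complex) (F :: ((nat \<Rightarrow> nat) \<Rightarrow> complex) \<Rightarrow> (nat list \<Rightarrow> complex)). \<lambda>v y. c * F v y" fscale
      by unfold_locales
    have lin: "Vector_Spaces.linear
        (\<lambda>(c::complex) (F :: ((nat \<Rightarrow> nat) \<Rightarrow> complex) \<Rightarrow> (nat list \<Rightarrow> complex)). \<lambda>v y. c * F v y) fscale ev"
      by unfold_locales (simp_all add: ev_def fun_eq_iff)
    have span: "hom_space.span B \<subseteq> H" using B(1) subH by (rule hom_space.span_minimal)
    have inj: "inj_on ev (hom_space.span B)"
    proof (rule inj_onI)
      fix F G assume FG: "F \<in> hom_space.span B" "G \<in> hom_space.span B" "ev F = ev G"
      have "F - G \<in> hom_space.span B" using FG(1,2) by (rule hom_space.span_diff)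
      then have "F - G \<in> H" using span by blast
      moreover have "(F - G) ?c = 0" using FG(3) by (simp add: ev_def)
      ultimately have "F - G = 0" unfolding H_def by (rule equiv_hom_eq_0)
      then show "F = G" by simp
    qed
    have "fun_space.independent (ev ` B)"
      using lin B(2) inj by (rule pair.linear_independent_injective_image)
    moreover have "ev ` B \<subseteq> tensor_space ?n (sum_list lam)"
      using B(1) schur_module_subset[of lam ?n] young_sym_alg_in_specht[of mu]
      by (force simp: H_def ev_def equiv_hom_def)
    ultimately have "finite (ev ` B)"
      using fun_space.independent_span_bound[OF finite_imageI[OF finite_lists_length_eq[OF finite_lessThan]]
          _ subset_trans[OF _ tensor_space_subset_span]]
      by blast
    moreover have "inj_on ev B" using inj hom_space.span_superset by (rule inj_on_subset)
    ultimately show ?thesis by (rule finite_imageD)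
  qed
  moreover have "B = {} \<longleftrightarrow> (\<forall>f\<in>H. f = 0)"
  proof
    assume "B = {}"
    then show "\<forall>f\<in>H. f = 0" using B(3) by (auto simp: hom_space.span_empty)
  next
    assume "\<forall>f\<in>H. f = 0"
    moreover have "0 \<notin> B" using B(2) hom_space.dependent_zero by blast
    ultimately show "B = {}" using B(1) by (metis all_not_in_conv subsetD)
  qed
  ultimately show ?thesis unfolding r H_def[symmetric] by (auto simp: card_gt_0_iff)
qed

section \<open>The bound on the Durfee square\<close>

context perm_rep
begin

lemma stab_alt_sum: "stab_alt f (sum h I) = (\<Sum>i\<in>I. stab_alt f (h i))"
  by (induction I rule: infinite_finite_induct) (simp_all add: stab_alt_zero stab_alt_add)

lemma act_stab_alt:
  "p \<in> label_stabilizer \<Omega> f \<Longrightarrow> act p (stab_alt f v) = of_int (sign p) *s stab_alt f v"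
  using act_swap_stab_alt by (rule act_alternating_label_stabilizer)

end

text \<open>Each class in which \<open>x\<close> occurs also contains \<open>y\<close>, and by
  \<open>inj\<close> each of them exactly once; transposing their two places in every such class
  exchanges the letters. The number of these transpositions gives the sign that separates even from
  odd letters.\<close>

lemma exists_place_permutation_swapping_letters:
  fixes u :: "nat list" and cls :: "nat \<Rightarrow> nat"
  defines "A \<equiv> \<lambda>z. cls ` {i. i < length u \<and> u ! i = z}"
  assumes inj: "inj_on (\<lambda>i. (u ! i, cls i)) {..<length u}"
    and xy: "x \<noteq> y" "A x = A y"
  obtains p where "p \<in> label_stabilizer {..<length u} cls"
    "map (transpose x y) u = permute_list p u" "sign p = (- 1) ^ card (A x)"
proof -
  let ?\<Omega> = "{..<length u}"
  have uniq: "i = j" if "i < length u" "j < length u" "u ! i = u ! j" "cls i = cls j" for i j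
    using inj that by (auto simp: inj_on_def)
  have finA: "finite (A x)" by (simp add: A_def)
  have "\<exists>p\<in>label_stabilizer ?\<Omega> cls.
      (\<forall>i<length u. u ! p i = (if cls i \<in> J then transpose x y (u ! i) else u ! i))
      \<and> sign p = (- 1) ^ card J" if "J \<subseteq> A x" for J
    using finite_subset[OF that finA] that
  proof (induction J rule: finite_induct)
    case empty
    show ?case by (rule bexI[of _ id]) (simp_all add: id_in_label_stabilizer)
  next
    case (insert j J)
    then obtain p where p: "p \<in> label_stabilizer ?\<Omega> cls" "sign p = (- 1) ^ card J"
      and up: "\<And>i. i < length u \<Longrightarrow> u ! p i = (if cls i \<in> J then transpose x y (u ! i) else u ! i)"
      by auto
    have "j \<in> A x" "j \<in> A y" using insert.prems xy by auto
    then obtain a b where a: "a < length u" "u ! a = x" "cls a = j"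
      and b: "b < length u" "u ! b = y" "cls b = j" by (auto simp: A_def)
    have ab: "a \<noteq> b" using a b xy by auto
    let ?q = "p \<circ> transpose a b"
    have t: "transpose a b \<in> label_stabilizer ?\<Omega> cls"
      using a b by (intro transpose_in_label_stabilizer) auto
    have q: "?q \<in> label_stabilizer ?\<Omega> cls" using p(1) t by (rule comp_in_label_stabilizer)
    have perm: "permutation p" "permutation (transpose a b)"
      using label_stabilizerD(1)[OF p(1)] label_stabilizerD(1)[OF t] permutation_permutes by blast+
    have "sign ?q = (- 1) ^ card (insert j J)"
      using perm p(2) ab insert.hyps by (simp add: sign_compose sign_swap_id)
    moreover have "u ! ?q i = (if cls i \<in> insert j J then transpose x y (u ! i) else u ! i)"
      if i: "i < length u" for i
    proof -
      consider "i = a" | "i = b" | "i \<noteq> a" "i \<noteq> b" by blast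
      then show ?thesis
      proof cases
        case 3
        then have "transpose x y (u ! i) = u ! i" if "cls i = j"
          using uniq[OF i a(1)] uniq[OF i b(1)] a b that by (auto simp: transpose_def)
        then show ?thesis using 3 up[OF i] by auto
      qed (use a b up insert.hyps in auto)
    qed
    ultimately show ?case using q by blast
  qed
  from this[OF order_refl] obtain p where p: "p \<in> label_stabilizer ?\<Omega> cls"
    "\<And>i. i < length u \<Longrightarrow> u ! p i = (if cls i \<in> A x then transpose x y (u ! i) else u ! i)"
    "sign p = (- 1) ^ card (A x)" by auto
  have "transpose x y (u ! i) = u ! p i" if i: "i < length u" for i
  proof (cases "cls i \<in> A x")
    case False
    then have "u ! i \<noteq> x" "u ! i \<noteq> y" using i xy by (auto simp: A_def)
    then show ?thesis using p(2)[OF i] False by simp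
  qed (use p(2)[OF i] in simp)
  then have "map (transpose x y) u = permute_list p u"
    using label_stabilizerD(1)[OF p(1)] by (intro nth_equalityI) (auto simp: permute_list_nth)
  then show thesis using that p by blast
qed

text \<open>The value at \<^term>\<open>g\<close> is forced to vanish by maximising the number of letters placed in the row
  named by their label (even letters) or in row \<^term>\<open>d\<close> (odd letters).\<close>

lemma card_row_le_of_symmetries:
  fixes \<Phi> :: "(nat \<Rightarrow> nat) \<Rightarrow> complex" and row lab :: "nat \<Rightarrow> nat" and od :: "nat \<Rightarrow> bool"
  assumes nz: "\<Phi> id \<noteq> 0"
    and row: "\<And>g x y. \<lbrakk>g permutes {..<n}; x < n; y < n; row x = row y\<rbrakk> \<Longrightarrow> \<Phi> (transpose x y \<circ> g) = \<Phi> g"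
    and rel: "\<And>g y i. \<lbrakk>g permutes {..<n}; y < n; i < row y\<rbrakk>
               \<Longrightarrow> \<Phi> g + (\<Sum>x | x \<in> {..<n} \<and> row x = i. \<Phi> (transpose x y \<circ> g)) = 0"
    and ev: "\<And>g x y. \<lbrakk>g permutes {..<n}; x < n; y < n; x \<noteq> y; \<not> od x; \<not> od y; lab x = lab y\<rbrakk>
               \<Longrightarrow> \<Phi> (g \<circ> transpose x y) = \<Phi> g"
    and od: "\<And>g x y. \<lbrakk>g permutes {..<n}; x < n; y < n; x \<noteq> y; od x; od y; lab x = lab y\<rbrakk>
               \<Longrightarrow> \<Phi> (g \<circ> transpose x y) = - \<Phi> g"
    and lab: "\<And>x. x < n \<Longrightarrow> lab x < d"
  shows "card {x \<in> {..<n}. row x = d} \<le> d"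
proof (rule ccontr)
  assume large: "\<not> ?thesis"
  define S where "S g = {x \<in> {..<n}. if od x then row (g x) = d else row (g x) = lab x}" for g
  define good where "good g \<longleftrightarrow> g permutes {..<n} \<and> \<Phi> g \<noteq> 0" for g
  have "good id" using nz by (simp add: good_def permutes_id)
  moreover have "card (S g) < Suc n" for g
  proof -
    have "S g \<subseteq> {..<n}" unfolding S_def by blast
    then have "card (S g) \<le> card {..<n}" by (intro card_mono) simp_all
    then show ?thesis by simp
  qed
  ultimately obtain g where "good g" and max: "\<And>g'. good g' \<Longrightarrow> card (S g') \<le> card (S g)"
    using ex_has_greatest_nat[of good id "\<lambda>g. card (S g)" "Suc n"] by blast
  then have g: "g permutes {..<n}" and \<Phi>g: "\<Phi> g \<noteq> 0" by (auto simp: good_def)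
  have gn: "g x < n \<longleftrightarrow> x < n" for x using permutes_in_image[OF g, of x] by simp
  have conj: "transpose (g x) (g y) \<circ> g = g \<circ> transpose x y" for x y
    using transpose_conjugate[OF permutes_bij[OF g]] by simp
  have reindex: "bij_betw g {x \<in> {..<n}. row (g x) = i} {x \<in> {..<n}. row x = i}" for i
  proof (rule bij_betw_byWitness[where f' = "inv g"])
    show "inv g ` {x \<in> {..<n}. row x = i} \<subseteq> {x \<in> {..<n}. row (g x) = i}"
      using permutes_in_image[OF permutes_inv[OF g]] permutes_inverses(1)[OF g] by auto
  qed (use gn permutes_inverses[OF g] in auto)
  \<comment> \<open>Two odd letters with equal label in row \<open>d\<close> would make the value at
    \<open>g\<close> both invariant and alternating under their exchange. With \<open>d\<close>
    labels available, a row of more than \<open>d\<close> cells must hold an even letter.\<close>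
  obtain x0 where x0: "x0 < n" "\<not> od x0" "row (g x0) = d"
  proof (rule ccontr)
    assume none: "\<not> thesis"
    let ?B = "{x \<in> {..<n}. row (g x) = d}"
    have B: "\<forall>x\<in>?B. od x" using none that by auto
    have "inj_on lab ?B"
    proof (rule inj_onI, rule ccontr)
      fix x y assume xy: "x \<in> ?B" "y \<in> ?B" "lab x = lab y" "x \<noteq> y"
      have "\<Phi> g = \<Phi> (transpose (g x) (g y) \<circ> g)" using row[OF g, of "g x" "g y"] xy gn by simp
      also have "\<dots> = \<Phi> (g \<circ> transpose x y)" by (simp only: conj)
      also have "\<dots> = - \<Phi> g" using od[OF g, of x y] xy B by auto
      finally show False using \<Phi>g by simp
    qed
    moreover have "lab ` ?B \<subseteq> {..<d}" using lab by auto
    ultimately have "card ?B \<le> card {..<d}" by (metis card_inj_on_le finite_lessThan)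
    then show False using large bij_betw_same_card[OF reindex[of d]] by simp
  qed
  define c where "c = lab x0"
  have cd: "c < d" using lab x0 by (simp add: c_def)
  let ?I = "{x \<in> {..<n}. row (g x) = c}"
  let ?E = "{x \<in> ?I. \<not> od x \<and> lab x = c}"
  have "0 = \<Phi> g + (\<Sum>x | x \<in> {..<n} \<and> row x = c. \<Phi> (transpose x (g x0) \<circ> g))"
    using rel[OF g, of "g x0" c] x0 gn cd by simp
  also have "(\<Sum>x | x \<in> {..<n} \<and> row x = c. \<Phi> (transpose x (g x0) \<circ> g))
      = (\<Sum>x\<in>?I. \<Phi> (transpose (g x) (g x0) \<circ> g))"
    by (rule sum.reindex_bij_betw[OF reindex, symmetric])
  \<comment> \<open>An even letter with label \<open>c\<close> can be exchanged with
    \<open>x0\<close> freely. Any other letter of row \<open>c\<close> is misplaced, so exchanging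
    it with \<open>x0\<close> puts \<open>x0\<close> right and spoils nothing; maximality forces the
    value to vanish. The relation thus becomes a positive multiple of the value at
    \<open>g\<close>.\<close>
  also have "\<dots> = (\<Sum>x\<in>?I. if \<not> od x \<and> lab x = c then \<Phi> g else 0)"
  proof (rule sum.cong)
    fix x assume x: "x \<in> ?I"
    have ne: "x \<noteq> x0" using x x0 cd by auto
    show "\<Phi> (transpose (g x) (g x0) \<circ> g) = (if \<not> od x \<and> lab x = c then \<Phi> g else 0)"
    proof (cases "\<not> od x \<and> lab x = c")
      case True
      then show ?thesis unfolding conj using ev[OF g, of x x0] x x0 ne by (simp add: c_def)
    next
      case False
      let ?g = "g \<circ> transpose x x0"
      have "S g \<subseteq> S ?g"
        using x x0 ne False cd by (auto simp: S_def c_def transpose_def split: if_splits)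
      moreover have "x0 \<in> S ?g" "x0 \<notin> S g"
        using x x0 ne cd by (auto simp: S_def c_def)
      ultimately have "S g \<subset> S ?g" by blast
      then have "card (S g) < card (S ?g)"
        by (intro psubset_card_mono) (simp_all add: S_def)
      then have "\<not> good ?g" using max[of ?g] by auto
      moreover have "?g permutes {..<n}"
        using g x x0 by (intro permutes_compose permutes_swap_id) auto
      ultimately show ?thesis unfolding conj using False by (auto simp: good_def)
    qed
  qed simp
  also have "\<dots> = of_nat (card ?E) * \<Phi> g"
    by (simp add: sum.If_cases Int_def conj_commute)
  finally have "(1 + of_nat (card ?E)) * \<Phi> g = 0" by (simp add: algebra_simps)
  then have "of_nat (Suc (card ?E)) = (0 :: complex)" using \<Phi>g by simp
  then show False by (rule notE[OF of_nat_neq_0])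
qed

text \<open>A subset of \<^term>\<open>{..<k}\<close> is determined by its parity and its trace on the first \<^term>\<open>k - 1\<close> points.\<close>

lemma exists_parity_code:
  assumes "1 \<le> k"
  shows "\<exists>code :: nat set \<Rightarrow> nat. (\<forall>A\<subseteq>{..<k}. code A < 2 ^ (k - 1))
    \<and> (\<forall>A\<subseteq>{..<k}. \<forall>B\<subseteq>{..<k}. even (card A) = even (card B) \<longrightarrow> code A = code B \<longrightarrow> A = B)
    \<and> (\<forall>r<2 ^ (k - 1). \<forall>b. \<exists>A\<subseteq>{..<k}. even (card A) = b \<and> code A = r)"
proof -
  obtain k' where k: "k = Suc k'" using assms by (cases k) auto
  have "\<exists>idx. bij_betw idx (Pow {..<k'}) {..<(2::nat) ^ k'}"
    by (rule finite_same_card_bij) (auto simp: card_Pow)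
  then obtain idx where idx: "bij_betw idx (Pow {..<k'}) {..<(2::nat) ^ k'}" by blast
  show ?thesis
  proof (intro exI[of _ "\<lambda>A. idx (A \<inter> {..<k'})"] conjI allI impI)
    show "idx (A \<inter> {..<k'}) < 2 ^ (k - 1)" for A
      using bij_betwE[OF idx] by (auto simp: k)
    show "A = B" if "A \<subseteq> {..<k}" "B \<subseteq> {..<k}" "even (card A) = even (card B)"
      "idx (A \<inter> {..<k'}) = idx (B \<inter> {..<k'})" for A B
    proof -
      have tr: "A \<inter> {..<k'} = B \<inter> {..<k'}"
        using that(4) bij_betw_imp_inj_on[OF idx] by (auto dest: inj_onD)
      have split: "card C = card (C \<inter> {..<k'}) + (if k' \<in> C then 1 else 0)" if "C \<subseteq> {..<k}" for C
      proof (cases "k' \<in> C")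
        case True
        then have "C = insert k' (C \<inter> {..<k'})" using that by (auto simp: k less_Suc_eq)
        then have "card C = card (insert k' (C \<inter> {..<k'}))" by (rule arg_cong)
        then show ?thesis using True by simp
      next
        case False
        then have "C \<inter> {..<k'} = C" using that by (auto simp: k less_Suc_eq)
        then show ?thesis using False by simp
      qed
      have "k' \<in> A \<longleftrightarrow> k' \<in> B" using split[OF that(1)] split[OF that(2)] that(3) tr by (auto split: if_splits)
      then show "A = B" using tr that(1,2) by (fastforce simp: k less_Suc_eq set_eq_iff)
    qed
    show "\<exists>A\<subseteq>{..<k}. even (card A) = b \<and> idx (A \<inter> {..<k'}) = r" if "r < 2 ^ (k - 1)" for r b
    proof -
      have "r \<in> idx ` Pow {..<k'}" using bij_betw_imp_surj_on[OF idx] that by (simp add: k)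
      then obtain C where C: "C \<subseteq> {..<k'}" "idx C = r" by auto
      have fin: "finite C" using C finite_subset by blast
      have tr: "k' \<notin> C" "C \<inter> {..<k'} = C" "insert k' C \<inter> {..<k'} = C" using C by auto
      have sub: "C \<subseteq> {..<k}" "insert k' C \<subseteq> {..<k}" using C by (auto simp: k)
      show ?thesis
      proof (cases "even (card C) = b")
        case True
        then show ?thesis using sub tr C by (intro exI[of _ C]) simp
      next
        case False
        then show ?thesis using sub tr C fin by (intro exI[of _ "insert k' C"]) simp
      qed
    qed
  qed
qed

text \<open>The image \<open>w\<close> of the Young symmetrizer is row-symmetrized in the places.
  Antisymmetrizing it over the columns of \<open>lam\<close> gives \<open>w'\<close>, nonzero by the
  Garnir relations; since the actions commute, \<open>w'\<close> keeps the row invariance and the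
  relations in the letters. Its values on renamings of one fixed word \<open>u\<close> are the
  function to be bounded.\<close>

lemma part_le_of_r_mult_pos:
  assumes mu: "is_partition mu" and k: "1 \<le> k" and lam: "is_partition lam" "part lam 1 \<le> k"
    and r: "r_mult lam mu > 0"
  shows "part mu (Suc (2 ^ (k - 1))) \<le> 2 ^ (k - 1)"
proof -
  let ?n = "sum_list mu" and ?m = "sum_list lam" and ?c = "young_sym_alg mu"
  interpret pos: perm_rep fscale "{..<?m}" "place_act ?m" by (rule perm_rep_place)
  interpret grp: perm_rep fscale "{..<?n}" specht_act by (rule perm_rep_specht)
  obtain f where f: "f \<in> equiv_hom (Sym ?n) (specht mu) specht_act (schur_module lam ?n) tensor_act" "f \<noteq> 0"
    using r r_mult_pos_iff by blast
  define w where "w = f ?c"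
  have w0: "w \<noteq> 0" using equiv_hom_eq_0[OF f(1)] f(2) by (auto simp: w_def)
  have "w \<in> schur_module lam ?n"
    using f(1) young_sym_alg_in_specht[of mu] by (simp add: w_def equiv_hom_def)
  then obtain T where T: "T \<in> tensor_space ?n ?m" "w = place_sum lam (place_alt lam T)"
    by (auto simp: schur_module_eq)
  define w' where "w' = place_alt lam w"
  have w'0: "w' \<noteq> 0"
    unfolding w'_def
  proof (rule pos.stab_alt_nonzero[OF diagram_down_closed[OF lam(1)] inj_on_col_row _ _ w0])
    show "place_act ?m (transpose x y) w = w"
      if "x \<in> {..<?m}" "y \<in> {..<?m}" "row_of lam x = row_of lam y" for x y
      unfolding T(2) using that by (rule pos.act_swap_stab_sum)
    show "w + (\<Sum>x | x \<in> {..<?m} \<and> row_of lam x = i. place_act ?m (transpose x y) w) = 0"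
      if "y \<in> {..<?m}" "i < row_of lam y" for y i
      unfolding T(2) using diagram_down_closed[OF lam(1)] pos.act_swap_stab_alt that
      by (rule pos.stab_sum_alternating_relation)
  qed
  have w'_row: "tensor_act (transpose x y) w' = w'" if "x < ?n" "y < ?n" "row_of mu x = row_of mu y" for x y
  proof -
    have "transpose x y \<in> Sym ?n" using that by (simp add: Sym_def permutes_swap_id)
    then have "tensor_act (transpose x y) w = f (specht_act (transpose x y) ?c)"
      unfolding w_def by (simp add: equiv_hom_act[OF f(1)] young_sym_alg_in_specht)
    also have "specht_act (transpose x y) ?c = ?c"
      unfolding young_sym_alg_eq using that by (intro grp.act_swap_stab_sum) auto
    finally show ?thesis by (simp add: w'_def tensor_act_place_alt w_def)
  qed
  have w'_rel: "w' + (\<Sum>x | x \<in> {..<?n} \<and> row_of mu x = i. tensor_act (transpose x y) w') = 0"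
    if y: "y < ?n" "i < row_of mu y" for y i
  proof -
    let ?I = "{x. x \<in> {..<?n} \<and> row_of mu x = i}"
    let ?H = "(\<lambda>x. transpose x y) ` ?I"
    have inj: "inj_on (\<lambda>x. transpose x y) ?I"
      by (rule inj_onI) (metis transpose_apply_second)
    have H: "?H \<subseteq> Sym ?n" using y by (auto simp: Sym_def permutes_swap_id)
    have "?c + (\<Sum>x\<in>?I. specht_act (transpose x y) ?c) = 0"
      unfolding young_sym_alg_eq
      by (rule grp.stab_sum_alternating_relation[where c = "col_of mu"])
         (use y diagram_down_closed[OF mu] grp.act_swap_stab_alt in auto)
    then have zero: "fscale 1 ?c + (\<Sum>h\<in>?H. fscale 1 (specht_act h ?c)) = 0"
      unfolding sum.reindex[OF inj] o_def fun_space.scale_one .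
    have mem: "(\<Sum>h\<in>?H. fscale 1 (specht_act h ?c)) \<in> specht mu"
      using H by (rule specht_partial_sum)
    have "f 0 = 0" using equiv_hom_sum[OF f(1), of "{}"] by simp
    then have "0 = f (fscale 1 ?c + (\<Sum>h\<in>?H. fscale 1 (specht_act h ?c)))" by (simp only: zero)
    also have "\<dots> = fscale 1 w + (\<Sum>h\<in>?H. fscale 1 (tensor_act h w))"
      unfolding w_def equiv_hom_lin[OF f(1) young_sym_alg_in_specht mem] equiv_hom_sum[OF f(1) H] ..
    also have "\<dots> = w + (\<Sum>x\<in>?I. tensor_act (transpose x y) w)"
      unfolding sum.reindex[OF inj] o_def fun_space.scale_one ..
    finally have "place_alt lam 0 = place_alt lam (w + (\<Sum>x\<in>?I. tensor_act (transpose x y) w))"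
      by (rule arg_cong)
    then show ?thesis
      by (simp add: pos.stab_alt_zero pos.stab_alt_add pos.stab_alt_sum w'_def tensor_act_place_alt)
  qed
  have "w \<in> tensor_space ?n ?m" using T by (simp add: place_sum_tensor_space place_alt_tensor_space)
  then have w'T: "w' \<in> tensor_space ?n ?m" unfolding w'_def by (rule place_alt_tensor_space)
  obtain u where u: "w' u \<noteq> 0" using w'0 by (auto simp: fun_eq_iff)
  have len: "length u = ?m" using w'T u by (auto simp: tensor_space_def)
  have w'_place: "w' (permute_list p v) = of_int (sign p) * w' v"
    if "p \<in> label_stabilizer {..<?m} (col_of lam)" "length v = ?m" for p v
    using fun_cong[OF pos.act_stab_alt[OF that(1), of w], of v] that(2)
    by (simp add: w'_def place_act_def)
  \<comment> \<open>A column-alternating tensor vanishes on words that repeat a letter in one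
    column.\<close>
  have inj: "inj_on (\<lambda>i. (u ! i, col_of lam i)) {..<length u}"
  proof (rule inj_onI, rule ccontr)
    fix i j assume ij: "i \<in> {..<length u}" "j \<in> {..<length u}"
      "(u ! i, col_of lam i) = (u ! j, col_of lam j)" "i \<noteq> j"
    have t: "transpose i j \<in> label_stabilizer {..<?m} (col_of lam)"
      using ij len by (intro transpose_in_label_stabilizer) auto
    have "permute_list (transpose i j) u = u"
      using ij len label_stabilizerD(1)[OF t]
      by (intro nth_equalityI) (auto simp: permute_list_nth transpose_def)
    then have "w' u = - w' u" using w'_place[OF t len] ij by (simp add: sign_swap_id)
    then show False using u by simp
  qed
  obtain code :: "nat set \<Rightarrow> nat" where code: "\<forall>A\<subseteq>{..<k}. code A < 2 ^ (k - 1)"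
    "\<forall>A\<subseteq>{..<k}. \<forall>B\<subseteq>{..<k}. even (card A) = even (card B) \<longrightarrow> code A = code B \<longrightarrow> A = B"
    using exists_parity_code[OF k] by auto
  define A where "A z = col_of lam ` {i. i < length u \<and> u ! i = z}" for z
  have colk: "col_of lam i < k" if "i < ?m" for i
  proof -
    note cd = cell_decomposition[OF that]
    have "lam ! row_of lam i \<le> lam ! 0"
      using is_partition_nth_mono[OF lam(1), of 0 "row_of lam i"] cd(1) by simp
    then show ?thesis using cd lam(2) by (cases lam) (auto simp: part_def)
  qed
  have Ak: "A z \<subseteq> {..<k}" for z using colk len by (auto simp: A_def)
  \<comment> \<open>Among subsets of equal parity \<open>code\<close> is injective, so equal labels
    mean equal column sets, and a letter exchange becomes a signed place permutation.\<close>
  have swap: "w' (map (g \<circ> transpose x y) u) = (- 1) ^ card (A x) * w' (map g u)"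
    if ne: "x \<noteq> y" and par: "even (card (A x)) = even (card (A y))" "code (A x) = code (A y)" for g x y
  proof -
    have eq: "A x = A y" using code(2) Ak par by blast
    obtain p where p: "p \<in> label_stabilizer {..<length u} (col_of lam)"
      "map (transpose x y) u = permute_list p u" "sign p = (- 1) ^ card (A x)"
      by (rule exists_place_permutation_swapping_letters[OF inj ne eq[unfolded A_def], folded A_def])
    have "map (g \<circ> transpose x y) u = permute_list p (map g u)"
      using p(2) label_stabilizerD(1)[OF p(1)] by (simp add: permute_list_map flip: map_map)
    then show ?thesis using w'_place[of p "map g u"] p len by simp
  qed
  have tact: "w' (map (transpose x y \<circ> g) u) = tensor_act (transpose x y) w' (map g u)" for x y g
    by (simp add: tensor_act_def)
  \<comment> \<open>Rows are numbered from 0 by \<open>row_of\<close> and from 1 by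
    \<open>part\<close>, so index 2^(k-1) is part number \<open>Suc (2 ^ (k - 1))\<close>.\<close>
  have "card {x \<in> {..<?n}. row_of mu x = 2 ^ (k - 1)} \<le> 2 ^ (k - 1)"
  proof (rule card_row_le_of_symmetries[where \<Phi> = "\<lambda>g. w' (map g u)"
        and lab = "\<lambda>x. code (A x)" and od = "\<lambda>x. odd (card (A x))"])
    show "w' (map id u) \<noteq> 0" using u by simp
    show "w' (map (transpose x y \<circ> g) u) = w' (map g u)"
      if "x < ?n" "y < ?n" "row_of mu x = row_of mu y" for g x y
      unfolding tact w'_row[OF that] ..
    show "w' (map g u) + (\<Sum>x | x \<in> {..<?n} \<and> row_of mu x = i. w' (map (transpose x y \<circ> g) u)) = 0"
      if "y < ?n" "i < row_of mu y" for g y i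
      unfolding tact using fun_cong[OF w'_rel[OF that], of "map g u"] by (simp add: fun_sum_apply)
    show "w' (map (g \<circ> transpose x y) u) = w' (map g u)"
      if "x \<noteq> y" "\<not> odd (card (A x))" "\<not> odd (card (A y))" "code (A x) = code (A y)" for g x y
      using swap that by simp
    show "w' (map (g \<circ> transpose x y) u) = - w' (map g u)"
      if "x \<noteq> y" "odd (card (A x))" "odd (card (A y))" "code (A x) = code (A y)" for g x y
      using swap that by simp
    show "code (A x) < 2 ^ (k - 1)" for x using code(1) Ak by blast
  qed
  then show ?thesis by (simp only: card_row)
qed

section \<open>Realising a hook shape\<close>

lemma place_act_add: "place_act m p (u + v) = place_act m p u + place_act m p v"
  and place_act_fscale: "place_act m p (fscale c v) = fscale c (place_act m p v)"
  by (auto simp: place_act_def fun_eq_iff)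

text \<open>This is the operator by which the group algebra element \<open>young_sym_alg mu\<close>
  acts on tensors through renaming of letters.\<close>

definition young_sym_letters :: "nat list \<Rightarrow> (nat list \<Rightarrow> complex) \<Rightarrow> (nat list \<Rightarrow> complex)" where
  "young_sym_letters mu T = letter_sum mu (letter_alt mu T)"

lemma young_sym_letters_add: "young_sym_letters mu (S + T) = young_sym_letters mu S + young_sym_letters mu T"
  and young_sym_letters_fscale: "young_sym_letters mu (fscale c T) = fscale c (young_sym_letters mu T)"
proof -
  interpret ten: perm_rep fscale "{..<sum_list mu}" tensor_act by (rule perm_rep_tensor)
  show "young_sym_letters mu (S + T) = young_sym_letters mu S + young_sym_letters mu T"
    "young_sym_letters mu (fscale c T) = fscale c (young_sym_letters mu T)"
    by (simp_all only: young_sym_letters_def ten.stab_alt_add ten.stab_sum_add ten.stab_alt_scale ten.stab_sum_scale)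
qed

lemma young_sym_letters_place_act:
  assumes "p permutes {..<m}"
  shows "young_sym_letters mu (place_act m p T) = place_act m p (young_sym_letters mu T)"
proof -
  interpret ten: perm_rep fscale "{..<sum_list mu}" tensor_act by (rule perm_rep_tensor)
  have sum: "place_act m p (letter_sum mu T) = letter_sum mu (place_act m p T)" for T
    by (rule ten.stab_sum_commute) (simp_all only: place_act_add place_act_fscale tensor_act_place_act[OF assms])
  have alt: "place_act m p (letter_alt mu T) = letter_alt mu (place_act m p T)" for T
    by (rule ten.stab_alt_commute) (simp_all only: place_act_add place_act_fscale tensor_act_place_act[OF assms])
  show ?thesis by (simp only: young_sym_letters_def sum alt)
qed

section \<open>From vectors to homomorphisms out of the Specht module\<close>

lemma specht_act_specht:
  assumes "s \<in> Sym (sum_list mu)" "v \<in> specht mu"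
  shows "specht_act s v \<in> specht mu"
proof -
  let ?n = "sum_list mu" and ?c = "young_sym_alg mu"
  interpret grp: perm_rep fscale "{..<?n}" specht_act by (rule perm_rep_specht)
  have s: "s permutes {..<?n}" using assms(1) by (simp add: Sym_def)
  obtain x where v: "v = (\<Sum>h\<in>Sym ?n. fscale (x h) (specht_act h ?c))"
    using assms(2) by (auto simp: specht_def conv_eq_sum)
  have Sym: "Sym ?n = label_stabilizer {..<?n} (\<lambda>_. 0)" by (simp add: Sym_def label_stabilizer_def)
  have "specht_act s v = (\<Sum>h\<in>Sym ?n. fscale (x h) (specht_act (s \<circ> h) ?c))"
    unfolding v using s by (subst grp.act_sum) (auto simp: grp.act_scale grp.act_comp Sym_def intro!: sum.cong)
  also have "\<dots> = (\<Sum>h\<in>Sym ?n. fscale (x (inv s \<circ> (s \<circ> h))) (specht_act (s \<circ> h) ?c))"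
    using permutes_inv_o(2)[OF s] by (simp add: o_assoc)
  also have "\<dots> = (\<Sum>h\<in>Sym ?n. fscale (x (inv s \<circ> h)) (specht_act h ?c))"
    by (rule sum.reindex_bij_betw[of "\<lambda>h. s \<circ> h"])
       (use bij_betw_comp_left_label_stabilizer assms(1) in \<open>simp add: Sym\<close>)
  also have "\<dots> \<in> specht mu" by (rule specht_partial_sum) simp
  finally show ?thesis .
qed

lemma specht_linear:
  assumes "u \<in> specht mu" "v \<in> specht mu"
  shows "(\<lambda>x. a * u x + v x) \<in> specht mu"
proof -
  let ?n = "sum_list mu" and ?c = "young_sym_alg mu"
  obtain x y where uv: "u = (\<Sum>h\<in>Sym ?n. fscale (x h) (specht_act h ?c))"
    "v = (\<Sum>h\<in>Sym ?n. fscale (y h) (specht_act h ?c))"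
    using assms by (auto simp: specht_def conv_eq_sum)
  have "(\<lambda>x. a * u x + v x) = (\<Sum>h\<in>Sym ?n. fscale (a * x h + y h) (specht_act h ?c))"
    by (simp add: fun_eq_iff uv fun_sum_apply sum_distrib_left sum.distrib algebra_simps)
  also have "\<dots> \<in> specht mu" by (rule specht_partial_sum) simp
  finally show ?thesis .
qed

text \<open>Applying group algebra elements to \<open>w\<close> is an equivariant map into the Schur
  module. Restricted to the Specht module it sends the Young symmetrizer to
  \<open>young_sym_letters mu w\<close>, hence is nonzero.\<close>

lemma r_mult_pos_of_vector:
  assumes w: "w \<in> schur_module lam (sum_list mu)" and nz: "young_sym_letters mu w \<noteq> 0"
  shows "r_mult lam mu > 0"
proof -
  let ?n = "sum_list mu" and ?c = "young_sym_alg mu"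
  interpret grp: perm_rep fscale "{..<?n}" specht_act by (rule perm_rep_specht)
  interpret ten: perm_rep fscale "{..<?n}" tensor_act by (rule perm_rep_tensor)
  define \<Psi> where "\<Psi> v = (\<Sum>h\<in>Sym ?n. fscale (v h) (tensor_act h w))" for v :: "(nat \<Rightarrow> nat) \<Rightarrow> complex"
  have lin: "\<Psi> (\<lambda>x. a * u x + v x) = (\<lambda>y. a * \<Psi> u y + \<Psi> v y)" for a u v
    by (simp add: fun_eq_iff \<Psi>_def fun_sum_apply sum_distrib_left sum.distrib algebra_simps)
  have add: "\<Psi> (u + v) = \<Psi> u + \<Psi> v" for u v
    using lin[of 1 u v] by (simp add: plus_fun_def)
  have scale: "\<Psi> (fscale a u) = fscale a (\<Psi> u)" for a u
    by (simp add: fun_eq_iff \<Psi>_def fun_sum_apply sum_distrib_left algebra_simps)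
  have zero: "\<Psi> 0 = 0" using scale[of 0 0] by simp
  have \<Psi>_sum: "\<Psi> (sum F I) = (\<Sum>i\<in>I. \<Psi> (F i))" for F and I :: "(nat \<Rightarrow> nat) set"
    by (induction I rule: infinite_finite_induct) (simp_all only: sum.infinite sum.empty sum.insert zero add not_False_eq_True)
  have Sym: "Sym ?n = label_stabilizer {..<?n} (\<lambda>_. 0)" by (simp add: Sym_def label_stabilizer_def)
  have equiv: "\<Psi> (specht_act g v) = tensor_act g (\<Psi> v)" if g: "g \<in> Sym ?n" for g v
  proof -
    have gp: "g permutes {..<?n}" using g by (simp add: Sym_def)
    have "\<Psi> (specht_act g v) = (\<Sum>h\<in>Sym ?n. fscale (v (inv g \<circ> (g \<circ> h))) (tensor_act (g \<circ> h) w))"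
      unfolding \<Psi>_def specht_act_def
      by (rule sum.reindex_bij_betw[of "\<lambda>h. g \<circ> h", symmetric])
         (use bij_betw_comp_left_label_stabilizer g in \<open>simp add: Sym\<close>)
    also have "\<dots> = (\<Sum>h\<in>Sym ?n. tensor_act g (fscale (v h) (tensor_act h w)))"
      using gp permutes_inv_o(2)[OF gp]
      by (intro sum.cong) (auto simp: o_assoc ten.act_comp tensor_act_fscale Sym_def)
    finally show ?thesis using gp by (simp add: \<Psi>_def ten.act_sum)
  qed
  have W: "\<Psi> v \<in> schur_module lam ?n" for v
    unfolding \<Psi>_def using w
    by (intro fun_space.subspace_sum fun_space.subspace_scale subspace_schur_module tensor_act_schur_module)
       (auto simp: Sym_def)
  define f where "f v = (if v \<in> specht mu then \<Psi> v else (\<lambda>_. 0))" for v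
  have "f \<in> equiv_hom (Sym ?n) (specht mu) specht_act (schur_module lam ?n) tensor_act"
    unfolding equiv_hom_def
    by (simp add: f_def W specht_linear lin specht_act_specht equiv)
  moreover have "f ?c \<noteq> 0"
  proof -
    have "tensor_act id w = w" by (simp add: tensor_act_def)
    then have "\<Psi> (delta id) = (\<Sum>h\<in>Sym ?n. if h = id then w else 0)"
      unfolding \<Psi>_def by (intro sum.cong refl) (simp add: delta_def)
    then have base: "\<Psi> (delta id) = w"
      by (simp only: sum.delta[OF finite_Sym] id_in_Sym if_True)
    have stab: "p \<in> Sym ?n" if "p \<in> label_stabilizer {..<?n} g" for p g
      using that by (simp add: Sym_def label_stabilizer_def)
    have sum: "\<Psi> (grp.stab_sum g u) = ten.stab_sum g (\<Psi> u)" for g u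
      unfolding grp.stab_sum_def ten.stab_sum_def \<Psi>_sum using equiv stab by (intro sum.cong refl) blast
    have alt: "\<Psi> (grp.stab_alt g u) = ten.stab_alt g (\<Psi> u)" for g u
      unfolding grp.stab_alt_def ten.stab_alt_def \<Psi>_sum scale using equiv stab
      by (intro sum.cong refl arg_cong2[where f = fscale]) blast
    have "\<Psi> ?c = young_sym_letters mu w"
      by (simp only: young_sym_alg_eq young_sym_letters_def sum alt base)
    then show ?thesis using nz young_sym_alg_in_specht by (simp add: f_def)
  qed
  then have "f \<noteq> 0" by (metis zero_fun_apply zero_fun_def)
  ultimately show ?thesis using r_mult_pos_iff by blast
qed

text \<open>The witness is a basis vector of the \<open>k\<close>-fold tensor power of the exterior algebra: the letter of a
  cell in row \<open>r < d\<close> occurs in the exterior factors belonging to the \<open>r\<close>-th even subset of \<open>{..<k}\<close>,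
  and the letter of any other cell in those belonging to the odd subset attached to its column.\<close>

lemma exists_exterior_tensor:
  assumes mu: "is_partition mu" and k: "1 \<le> k" and hook: "part mu (Suc (2 ^ (k - 1))) \<le> 2 ^ (k - 1)"
  obtains m T where "T \<in> tensor_space (sum_list mu) m" "young_sym_letters mu T \<noteq> 0"
    "\<And>S. \<lbrakk>S \<subseteq> {..<m}; card S = Suc k\<rbrakk> \<Longrightarrow> perm_rep.sym_sum (place_act m) S T = 0"
proof -
  let ?n = "sum_list mu"
  define d :: nat where "d = 2 ^ (k - 1)"
  obtain code :: "nat set \<Rightarrow> nat"
    where code: "\<forall>r<2 ^ (k - 1). \<forall>b. \<exists>A\<subseteq>{..<k}. even (card A) = b \<and> code A = r"
    using exists_parity_code[OF k] by auto
  define B where "B b r = (SOME A. A \<subseteq> {..<k} \<and> even (card A) = b \<and> code A = r)" for b r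
  have B: "B b r \<subseteq> {..<k}" "even (card (B b r)) = b" "code (B b r) = r" if "r < d" for b r
  proof -
    have "\<exists>A. A \<subseteq> {..<k} \<and> even (card A) = b \<and> code A = r" using code that unfolding d_def by blast
    from someI_ex[OF this] show "B b r \<subseteq> {..<k}" "even (card (B b r)) = b" "code (B b r) = r"
      unfolding B_def by auto
  qed
  define A where "A x = (if row_of mu x < d then B True (row_of mu x) else B False (col_of mu x))" for x
  \<comment> \<open>Here the hook condition enters: cells from row index \<open>d\<close> on lie in
    the first \<open>d\<close> columns, so there are enough odd subsets for them.\<close>
  have cold: "col_of mu x < d" if "x < ?n" "\<not> row_of mu x < d" for x
  proof -
    note cd = cell_decomposition[OF that(1)]
    have "mu ! row_of mu x \<le> mu ! d" using is_partition_nth_mono[OF mu] cd(1) that(2) by simp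
    moreover have "mu ! d \<le> d" using hook cd(1) that(2) by (simp add: part_def d_def)
    ultimately show ?thesis using cd(2) by simp
  qed
  have A: "A x \<subseteq> {..<k}" "even (card (A x)) \<longleftrightarrow> row_of mu x < d"
    "code (A x) = (if row_of mu x < d then row_of mu x else col_of mu x)" if "x < ?n" for x
    using B cold[OF that] by (auto simp: A_def)
  have same: "(row_of mu x < d \<longleftrightarrow> row_of mu y < d) \<and> (row_of mu x < d \<longrightarrow> row_of mu x = row_of mu y)
      \<and> (\<not> row_of mu x < d \<longrightarrow> col_of mu x = col_of mu y)" if "x < ?n" "y < ?n" "A x = A y" for x y
    using A(2,3)[OF that(1)] A(2,3)[OF that(2)] that(3) by (auto split: if_splits)
  \<comment> \<open>The places of the tensor are the pairs of a letter and an exterior factor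
    containing it, listed in any order; \<open>w\<close> records the letters and \<open>cls\<close>
    the factors.\<close>
  have finP: "finite {(x, j). x < ?n \<and> j \<in> A x}"
    by (rule finite_subset[of _ "{..<?n} \<times> {..<k}"]) (use A(1) in auto)
  then obtain L where L: "set L = {(x, j). x < ?n \<and> j \<in> A x}" "distinct L"
    using finite_distinct_list by blast
  define m where "m = length L"
  define w where "w = map fst L"
  define cls where "cls i = snd (L ! i)" for i
  have lenw: "length w = m" by (simp add: w_def m_def)
  have Li: "w ! i < ?n" "cls i \<in> A (w ! i)" "L ! i = (w ! i, cls i)" if "i < m" for i
    using nth_mem[of i L] that L(1) by (auto simp: w_def cls_def m_def)
  have ex: "\<exists>i<m. w ! i = x \<and> cls i = j" if "x < ?n" "j \<in> A x" for x j
  proof -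
    have "(x, j) \<in> set L" using that L(1) by simp
    then obtain i where "i < m" "L ! i = (x, j)" by (auto simp: in_set_conv_nth m_def)
    then show ?thesis by (auto simp: w_def cls_def m_def)
  qed
  have inj: "inj_on (\<lambda>i. (w ! i, cls i)) {..<length w}"
  proof (rule inj_onI)
    fix i j assume "i \<in> {..<length w}" "j \<in> {..<length w}" "(w ! i, cls i) = (w ! j, cls j)"
    then have "L ! i = L ! j" "i < length L" "j < length L" using Li(3)[of i] Li(3)[of j] by (auto simp: lenw m_def)
    then show "i = j" using L(2) by (simp add: nth_eq_iff_index_eq)
  qed
  have A_eq: "cls ` {i. i < length w \<and> w ! i = x} = A x" if "x < ?n" for x
    using Li(2) ex[OF that] unfolding lenw by fastforce
  interpret pos: perm_rep fscale "{..<m}" "place_act m" by (rule perm_rep_place)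
  interpret ten: perm_rep fscale "{..<?n}" tensor_act by (rule perm_rep_tensor)
  define e :: "nat list \<Rightarrow> complex" where "e u = (if u = w then 1 else 0)" for u
  define Q where "Q = label_stabilizer {..<m} cls"
  define T where "T = pos.stab_alt cls e"
  have eT: "e \<in> tensor_space ?n m"
    using Li(1) by (auto simp: e_def tensor_space_def lenw in_set_conv_nth)
  then have TT: "T \<in> tensor_space ?n m"
    unfolding T_def pos.stab_alt_def
    by (intro fun_space.subspace_sum fun_space.subspace_scale subspace_tensor_space place_act_tensor_space)
       (auto intro: label_stabilizerD)
  have T_val: "T u = (\<Sum>q\<in>Q. of_int (sign q) * (if permute_list q u = w then 1 else 0))" if "length u = m" for u
    using that by (simp add: T_def pos.stab_alt_def Q_def fun_sum_apply place_act_def e_def)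
  have Qp: "q permutes {..<m}" "\<And>i. i < m \<Longrightarrow> cls (q i) = cls i" if "q \<in> Q" for q
    using that by (auto simp: Q_def label_stabilizer_def)
  have Qm: "q i < m" if "q \<in> Q" "i < m" for q i
    using permutes_in_image[OF Qp(1)[OF that(1)], of i] that(2) by simp
  have Tw: "T w = 1"
  proof -
    have "permute_list q w = w \<longleftrightarrow> q = id" if q: "q \<in> Q" for q
    proof
      assume eq: "permute_list q w = w"
      have "q i = i" if i: "i < m" for i
      proof -
        have "w ! q i = w ! i" using arg_cong[OF eq, of "\<lambda>u. u ! i"] i Qp(1)[OF q] by (simp add: permute_list_nth lenw)
        then show ?thesis using inj Qp(2)[OF q i] Qm[OF q i] i by (auto simp: inj_on_def lenw)
      qed
      then have "q i = id i" for i using permutes_not_in[OF Qp(1)[OF q], of i] by (cases "i < m") auto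
      then show "q = id" by (rule ext)
    qed simp
    then have "T w = (\<Sum>q\<in>Q. if q = id then 1 else 0)"
      unfolding T_val[OF lenw] by (intro sum.cong) auto
    also have "\<dots> = 1"
      using id_in_label_stabilizer finite_label_stabilizer[of "{..<m}" cls] by (simp add: Q_def)
    finally show ?thesis .
  qed
  \<comment> \<open>A word in the support of \<open>T\<close> is \<open>w\<close> reordered inside
    the factors. If renaming by \<open>inv s\<close> gives such a word, each letter and its image
    under \<open>s\<close> occur in the same factors.\<close>
  have T_supp: "A (s x) = A x" if s: "s permutes {..<?n}" and nz: "T (map (inv s) w) \<noteq> 0" and x: "x < ?n" for s x
  proof -
    have "\<exists>q\<in>Q. permute_list q (map (inv s) w) = w"
    proof (rule ccontr)
      assume "\<not> ?thesis"
      then have "T (map (inv s) w) = 0" by (simp add: T_val lenw)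
      then show False using nz by simp
    qed
    then obtain q where q: "q \<in> Q" "permute_list q (map (inv s) w) = w" by blast
    have qi: "inv s (w ! q i) = w ! i" if "i < m" for i
      using arg_cong[OF q(2), of "\<lambda>u. u ! i"] that Qp(1)[OF q(1)] Qm[OF q(1) that] by (simp add: permute_list_nth lenw)
    have "j \<in> A (s x)" if j: "j \<in> A x" for j
    proof -
      obtain i where i: "i < m" "w ! i = x" "cls i = j" using ex[OF x j] by blast
      have "s x = w ! q i" using qi[OF i(1)] i(2) permutes_inverses(1)[OF s, of "w ! q i"] by simp
      then show ?thesis using Li(2)[OF Qm[OF q(1) i(1)]] Qp(2)[OF q(1) i(1)] i(3) by simp
    qed
    moreover have "j \<in> A x" if j: "j \<in> A (s x)" for j
    proof -
      have sx: "s x < ?n" using permutes_in_image[OF s, of x] x by simp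
      obtain i where i: "i < m" "w ! i = s x" "cls i = j" using ex[OF sx j] by blast
      define i' where "i' = inv q i"
      have i': "i' < m" "q i' = i"
        using permutes_in_image[OF permutes_inv[OF Qp(1)[OF q(1)]], of i] i(1) permutes_inverses(1)[OF Qp(1)[OF q(1)]]
        by (simp_all add: i'_def)
      have "w ! i' = x" using qi[OF i'(1)] i' i(2) permutes_inverses(2)[OF s] by simp
      then show ?thesis using Li(2)[OF i'(1)] Qp(2)[OF q(1) i'(1)] i' i(3) by simp
    qed
    ultimately show ?thesis by blast
  qed
  have T_swap: "tensor_act (transpose x y) T = fscale ((- 1) ^ card (A x)) T"
    if x: "x < ?n" and y: "y < ?n" and ne: "x \<noteq> y" and eq: "A x = A y" for x y
  proof -
    have eq': "cls ` {i. i < length w \<and> w ! i = x} = cls ` {i. i < length w \<and> w ! i = y}"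
      using eq A_eq x y by simp
    obtain p where p: "p \<in> label_stabilizer {..<length w} cls" "map (transpose x y) w = permute_list p w"
      "sign p = (- 1) ^ card (cls ` {i. i < length w \<and> w ! i = x})"
      by (rule exists_place_permutation_swapping_letters[OF inj ne eq'])
    have pQ: "p \<in> Q" using p(1) by (simp add: Q_def lenw)
    have pm: "p permutes {..<m}" using Qp(1)[OF pQ] .
    have ipQ: "inv p \<in> Q" using pQ unfolding Q_def by (rule inv_in_label_stabilizer)
    have "tensor_act (transpose x y) e = place_act m (inv p) e"
    proof
      fix u
      have 1: "map (transpose x y) u = w \<longleftrightarrow> u = permute_list p w"
        unfolding p(2)[symmetric] by (auto simp: map_idI)
      have 2: "permute_list (inv p) u = w \<longleftrightarrow> u = permute_list p w" if len: "length u = m"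
      proof
        assume "permute_list (inv p) u = w"
        then show "u = permute_list p w"
          using permute_list_compose[of p u "inv p"] pm permutes_inv_o(2)[OF pm] len by simp
      next
        assume "u = permute_list p w"
        then show "permute_list (inv p) u = w"
          using permute_list_compose[of "inv p" w p] permutes_inv[OF pm] permutes_inv_o(1)[OF pm] lenw by simp
      qed
      show "tensor_act (transpose x y) e u = place_act m (inv p) e u"
      proof (cases "length u = m")
        case True
        then show ?thesis by (simp add: tensor_act_def place_act_def e_def 1 2)
      next
        case False
        then have "u \<noteq> w" "u \<noteq> permute_list p w" using lenw by auto
        then show ?thesis using False by (simp add: tensor_act_def place_act_def e_def 1)
      qed
    qed
    moreover have "tensor_act (transpose x y) T = pos.stab_alt cls (tensor_act (transpose x y) e)"
      unfolding T_def
      by (rule pos.stab_alt_commute) (simp_all only: tensor_act_add tensor_act_fscale tensor_act_place_act)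
    ultimately have "tensor_act (transpose x y) T = fscale (of_int (sign (inv p))) T"
      using pos.stab_alt_absorb[OF ipQ[unfolded Q_def], of e] by (simp add: T_def)
    moreover have "sign (inv p) = (- 1) ^ card (A x)"
      using sign_inverse[OF pos.permutation_of_permutes[OF pm]] p(3) A_eq[OF x] by simp
    ultimately show ?thesis by simp
  qed
  define R C where "R = label_stabilizer {..<?n} (row_of mu)" and "C = label_stabilizer {..<?n} (col_of mu)"
  \<comment> \<open>The labels \<open>d + x\<close> isolate single cells, so \<open>p\<close> moves
    only cells of the first \<open>d\<close> rows and \<open>q\<close> only the others. The
    composite preserves \<open>A\<close>: for \<open>x\<close> in the first \<open>d\<close> rows
    this keeps \<open>q x\<close> in the row of \<open>x\<close>, and hence \<open>q x = x\<close>;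
    for lower cells it keeps \<open>p z\<close> in the column of \<open>z\<close>.\<close>
  have rigid: "p \<in> label_stabilizer {..<?n} (\<lambda>x. if row_of mu x < d then row_of mu x else d + x)
      \<and> q \<in> label_stabilizer {..<?n} (\<lambda>x. if row_of mu x < d then d + x else col_of mu x)"
    if p: "p \<in> R" and q: "q \<in> C" and nz: "T (map (inv (p \<circ> q)) w) \<noteq> 0" for p q
  proof -
    have pp: "p permutes {..<?n}" and qp: "q permutes {..<?n}"
      using p q by (simp_all add: R_def C_def label_stabilizer_def)
    have pn: "p x < ?n" and qn: "q x < ?n" if "x < ?n" for x
      using permutes_in_image[OF pp, of x] permutes_in_image[OF qp, of x] that by simp_all
    have prow: "row_of mu (p x) = row_of mu x" and qcol: "col_of mu (q x) = col_of mu x" if "x < ?n" for x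
      using p q that by (simp_all add: R_def C_def label_stabilizer_def)
    have cell: "x = y" if "x < ?n" "y < ?n" "row_of mu x = row_of mu y" "col_of mu x = col_of mu y" for x y
      using inj_on_col_row[of mu] that by (auto simp: inj_on_def)
    have S: "A (p (q x)) = A x" if "x < ?n" for x
      using T_supp[OF permutes_compose[OF qp pp] nz that] by simp
    have qfix: "q x = x" if x: "x < ?n" "row_of mu x < d" for x
    proof -
      have "row_of mu (q x) = row_of mu x"
        using same[OF pn[OF qn[OF x(1)]] x(1) S[OF x(1)]] x(2) prow[OF qn[OF x(1)]] by simp
      then show ?thesis using cell[OF qn[OF x(1)] x(1)] qcol[OF x(1)] by simp
    qed
    have pfix: "p z = z" if z: "z < ?n" "\<not> row_of mu z < d" for z
    proof -
      define x where "x = inv q z"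
      have x: "x < ?n" "q x = z"
        using permutes_in_image[OF permutes_inv[OF qp], of z] permutes_inverses(1)[OF qp] z(1) by (simp_all add: x_def)
      have nx: "\<not> row_of mu x < d" using qfix[OF x(1)] x(2) z(2) by auto
      have "col_of mu (p z) = col_of mu x"
        using same[OF x(1) pn[OF z(1)]] S[OF x(1)] x(2) nx by simp
      also have "\<dots> = col_of mu z" using qcol[OF x(1)] x(2) by simp
      finally show ?thesis using cell[OF pn[OF z(1)] z(1)] prow[OF z(1)] by simp
    qed
    have qrow: "\<not> row_of mu (q x) < d" if "x < ?n" "\<not> row_of mu x < d" for x
    proof
      assume "row_of mu (q x) < d"
      then have "q (q x) = q x" using qfix[OF qn[OF that(1)]] by simp
      then have "q x = x" using permutes_inj[OF qp] by (simp add: inj_eq)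
      then show False using \<open>row_of mu (q x) < d\<close> that by simp
    qed
    show ?thesis
      using pp qp pfix qfix prow qcol qrow by (auto simp: label_stabilizer_def)
  qed
  \<comment> \<open>In a surviving pair \<open>q\<close> permutes letters with equal odd sets and
    produces its own sign, which cancels \<open>sign q\<close>, while \<open>p\<close> permutes
    letters with equal even sets and acts trivially. The coefficient at \<open>w\<close> therefore
    counts surviving pairs, among them \<open>(id, id)\<close>.\<close>
  have sum01: "of_int (sign q) * tensor_act p (tensor_act q T) w
      = (if T (map (inv (p \<circ> q)) w) \<noteq> 0 then 1 else 0)" if p: "p \<in> R" and q: "q \<in> C" for p q
  proof (cases "T (map (inv (p \<circ> q)) w) = 0")
    case True
    have "tensor_act p (tensor_act q T) = tensor_act (p \<circ> q) T"
      using p q by (simp add: ten.act_comp R_def C_def label_stabilizer_def)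
    then show ?thesis using True by (simp add: tensor_act_def)
  next
    case False
    note r = rigid[OF p q False]
    have "tensor_act q T = fscale (of_int (sign q)) T"
    proof (rule ten.act_alternating_label_stabilizer[OF _ conjunct2[OF r]])
      fix x y assume xy: "x \<in> {..<?n}" "y \<in> {..<?n}" "x \<noteq> y"
        "(if row_of mu x < d then d + x else col_of mu x) = (if row_of mu y < d then d + y else col_of mu y)"
      have "\<not> row_of mu x < d" "\<not> row_of mu y < d" "col_of mu x = col_of mu y"
        using xy cold[of x] cold[of y] by (auto split: if_splits)
      then show "tensor_act (transpose x y) T = - T"
        using T_swap[of x y] A(2)[of x] xy by (simp add: A_def)
    qed
    moreover have "tensor_act p T = T"
    proof (rule ten.act_invariant_label_stabilizer[OF _ conjunct1[OF r]])
      fix x y assume xy: "x \<in> {..<?n}" "y \<in> {..<?n}" "x \<noteq> y"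
        "(if row_of mu x < d then row_of mu x else d + x) = (if row_of mu y < d then row_of mu y else d + y)"
      have "row_of mu x < d" "row_of mu y < d" "row_of mu x = row_of mu y"
        using xy by (auto split: if_splits)
      then show "tensor_act (transpose x y) T = T"
        using T_swap[of x y] A(2)[of x] xy by (simp add: A_def)
    qed
    ultimately have "tensor_act p (tensor_act q T) w = of_int (sign q) * T w"
      by (simp add: tensor_act_fscale)
    then show ?thesis using Tw False by (simp flip: of_int_mult)
  qed
  have "tensor_act p (ten.stab_alt (col_of mu) T) = (\<Sum>q\<in>C. fscale (of_int (sign q)) (tensor_act p (tensor_act q T)))"
    if "p \<in> R" for p
    using label_stabilizerD(1)[OF that[unfolded R_def]]
    by (simp add: ten.stab_alt_def ten.act_sum tensor_act_fscale C_def)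
  then have "young_sym_letters mu T = (\<Sum>p\<in>R. \<Sum>q\<in>C. fscale (of_int (sign q)) (tensor_act p (tensor_act q T)))"
    unfolding young_sym_letters_def ten.stab_sum_def R_def[symmetric] by (rule sum.cong[OF refl])
  then have "young_sym_letters mu T w = (\<Sum>p\<in>R. \<Sum>q\<in>C. of_int (sign q) * tensor_act p (tensor_act q T) w)"
    by (simp only: fun_sum_apply fscale_apply)
  also have "\<dots> = (\<Sum>z\<in>R \<times> C. if T (map (inv (fst z \<circ> snd z)) w) \<noteq> 0 then 1 else 0)"
    unfolding sum.cartesian_product by (intro sum.cong) (auto simp: sum01)
  also have "\<dots> = of_nat (card {z \<in> R \<times> C. T (map (inv (fst z \<circ> snd z)) w) \<noteq> 0})"
    using finite_label_stabilizer[of "{..<?n}"] by (simp add: sum.If_cases R_def C_def Int_def)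
  also have "\<dots> \<noteq> 0"
  proof -
    have "(id, id) \<in> {z \<in> R \<times> C. T (map (inv (fst z \<circ> snd z)) w) \<noteq> 0}"
      using Tw id_in_label_stabilizer by (simp add: R_def C_def)
    moreover have "finite {z \<in> R \<times> C. T (map (inv (fst z \<circ> snd z)) w) \<noteq> 0}"
      using finite_label_stabilizer[of "{..<?n}"] by (simp add: R_def C_def)
    ultimately show ?thesis unfolding of_nat_eq_0_iff card_eq_0_iff by blast
  qed
  finally have nz: "young_sym_letters mu T \<noteq> 0" by (auto simp: fun_eq_iff)
  show thesis
  proof (rule that[OF TT nz])
    fix S assume S: "S \<subseteq> {..<m}" "card S = Suc k"
    \<comment> \<open>Pigeonhole: among \<open>k + 1\<close> places two belong to the same one of
      the \<open>k\<close> factors.\<close>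
    have "cls ` S \<subseteq> {..<k}" using Li(1,2) A(1) S(1) by blast
    then have "card (cls ` S) < card S" using S(2) card_mono[of "{..<k}" "cls ` S"] by simp
    then have "\<not> inj_on cls S" using card_image by fastforce
    then obtain i j where ij: "i \<in> S" "j \<in> S" "i \<noteq> j" "cls i = cls j" by (auto simp: inj_on_def)
    then have "place_act m (transpose i j) T = - T"
      unfolding T_def using S(1) by (intro pos.act_swap_stab_alt) auto
    then show "pos.sym_sum S T = 0" using S(1) ij by (intro pos.sym_sum_eq_0)
  qed
qed

text \<open>The exterior tensor need not lie in a single Schur module. \<open>X\<close> consists of
  the images under \<open>young_sym_letters mu\<close> killed by symmetrizing any
  \<open>k + 1\<close> places: being an image records the occurrence of \<open>mu\<close>, and the
  vanishing bounds the rows. \<open>X\<close> is stable under places and nonzero, and an extremal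
  alternating vector in it supplies the shape \<open>lam\<close> through its blocks.\<close>

lemma exists_partition_of_hook:
  assumes mu: "is_partition mu" and k: "1 \<le> k" and hook: "part mu (Suc (2 ^ (k - 1))) \<le> 2 ^ (k - 1)"
  shows "\<exists>lam. is_partition lam \<and> part lam 1 \<le> k \<and> r_mult lam mu > 0"
proof -
  let ?n = "sum_list mu" and ?F = "young_sym_letters mu"
  obtain m T where T: "T \<in> tensor_space ?n m" "?F T \<noteq> 0"
    "\<forall>S\<subseteq>{..<m}. card S = Suc k \<longrightarrow> perm_rep.sym_sum (place_act m) S T = 0"
    using exists_exterior_tensor[OF assms] by metis
  interpret pos: perm_rep fscale "{..<m}" "place_act m" by (rule perm_rep_place)
  have F: "?F (S + T) = ?F S + ?F T" "?F (fscale c T) = fscale c (?F T)"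
    "p permutes {..<m} \<Longrightarrow> ?F (place_act m p T) = place_act m p (?F T)" for S T c p
    by (rule young_sym_letters_add young_sym_letters_fscale young_sym_letters_place_act; assumption?)+
  have F_sym: "?F (pos.sym_sum S v) = pos.sym_sum S (?F v)" if "S \<subseteq> {..<m}" for S v
    by (rule pos.sym_sum_commute[where F = ?F, OF F that])
  have F_sum: "?F (pos.stab_sum g v) = pos.stab_sum g (?F v)" for g v
    by (rule pos.stab_sum_commute[where F = ?F, OF F])
  have F_alt: "?F (pos.stab_alt g v) = pos.stab_alt g (?F v)" for g v
    by (rule pos.stab_alt_commute[where F = ?F, OF F])
  define X where "X = {v \<in> ?F ` tensor_space ?n m. \<forall>S\<subseteq>{..<m}. card S = Suc k \<longrightarrow> pos.sym_sum S v = 0}"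
  have F0: "?F 0 = 0" using young_sym_letters_fscale[of mu 0 0] by simp
  have subX: "fun_space.subspace X"
  proof (rule fun_space.subspaceI)
    show "0 \<in> X"
      using F0 fun_space.subspace_0[OF subspace_tensor_space] by (force simp: X_def pos.sym_sum_zero)
    show "u + v \<in> X" if "u \<in> X" "v \<in> X" for u v
      using that fun_space.subspace_add[OF subspace_tensor_space]
      by (auto simp: X_def pos.sym_sum_add simp flip: young_sym_letters_add)
    show "fscale c v \<in> X" if "v \<in> X" for c v
      using that fun_space.subspace_scale[OF subspace_tensor_space]
      by (auto simp: X_def pos.sym_sum_scale simp flip: young_sym_letters_fscale)
  qed
  have actX: "place_act m g v \<in> X" if g: "g permutes {..<m}" and v: "v \<in> X" for g v
  proof -
    have "pos.sym_sum S (place_act m g v) = 0" if S: "S \<subseteq> {..<m}" "card S = Suc k" for S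
    proof -
      have gS: "inv g ` S \<subseteq> {..<m}" using permutes_image[OF permutes_inv[OF g]] S(1) by blast
      have "card (inv g ` S) = Suc k"
        using card_image[OF inj_on_subset[OF permutes_inj[OF permutes_inv[OF g]]], of S] S(2) by simp
      then have "pos.sym_sum (inv g ` S) v = 0" using v gS by (simp add: X_def)
      moreover have "g ` inv g ` S = S" using permutes_inv_o(1)[OF g] by (simp add: image_comp)
      ultimately show ?thesis using pos.sym_sum_conj[OF g gS, of v] g by (simp add: pos.act_zero)
    qed
    moreover have "place_act m g v \<in> ?F ` tensor_space ?n m"
    proof -
      obtain T' where T': "T' \<in> tensor_space ?n m" "v = ?F T'" using v by (auto simp: X_def)
      show ?thesis
        unfolding T'(2) young_sym_letters_place_act[OF g, symmetric]
        using place_act_tensor_space[OF g T'(1)] by (rule imageI)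
    qed
    ultimately show ?thesis by (simp add: X_def)
  qed
  have "pos.sym_sum S (?F T) = 0" if "S \<subseteq> {..<m}" "card S = Suc k" for S
    unfolding F_sym[OF that(1), symmetric] using T(3) that F0 by simp
  then have FX: "?F T \<in> X" using T(1) by (simp add: X_def)
  obtain v and c :: "nat \<Rightarrow> nat" where v: "v \<in> X" "v \<noteq> 0"
    and anti: "\<forall>x\<in>{..<m}. \<forall>y\<in>{..<m}. x \<noteq> y \<longrightarrow> c x = c y \<longrightarrow> place_act m (transpose x y) v = - v"
    and rel: "\<forall>y\<in>{..<m}. \<forall>i. c y \<noteq> i \<longrightarrow> card {x \<in> {..<m}. c x = c y} \<le> card {x \<in> {..<m}. c x = i}
           \<longrightarrow> (\<Sum>x | x \<in> {..<m} \<and> c x = i. place_act m (transpose x y) v) = v"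
    using pos.exists_extremal_alternating[OF subX actX FX T(2)] by blast
  obtain lam h where lam: "is_partition lam" "sum_list lam = m" and h: "h permutes {..<m}"
    and "\<forall>x<m. \<forall>y<m. c x = c y \<longleftrightarrow> col_of lam (h x) = col_of lam (h y)"
    by (rule exists_partition_with_columns)
  then have hc: "c x = c y \<longleftrightarrow> col_of lam (h x) = col_of lam (h y)" if "x < m" "y < m" for x y
    using that by blast
  define v' where "v' = place_act m h v"
  have v': "v' \<in> X" "v' \<noteq> 0" unfolding v'_def using actX[OF h v(1)] pos.act_eq_0_iff[OF h] v(2) by auto
  have hm: "h x < m \<longleftrightarrow> x < m" and ihm: "inv h x < m \<longleftrightarrow> x < m" for x
    using permutes_in_image[OF h, of x] permutes_in_image[OF permutes_inv[OF h], of x] by simp_all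
  have hi: "h (inv h x) = x" and ih: "inv h (h x) = x" for x using permutes_inverses[OF h] by simp_all
  have anti': "place_act m (transpose x y) v' = - v'"
    if "x \<in> {..<m}" "y \<in> {..<m}" "x \<noteq> y" "col_of lam x = col_of lam y" for x y
  proof -
    have "place_act m h (place_act m (transpose (inv h x) (inv h y)) v) = place_act m (transpose x y) v'"
      using pos.act_conj[OF h, of "inv h x" "inv h y" v] that by (simp add: ihm hi v'_def)
    moreover have "place_act m (transpose (inv h x) (inv h y)) v = - v"
    proof (rule anti[rule_format])
      show "inv h x \<noteq> inv h y" using that(3) hi by metis
      show "c (inv h x) = c (inv h y)" using hc[of "inv h x" "inv h y"] that by (simp add: ihm hi)
    qed (use that in \<open>simp_all add: ihm\<close>)
    ultimately show ?thesis using h by (simp add: pos.act_minus v'_def)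
  qed
  have fiber: "bij_betw h {x. x \<in> {..<m} \<and> c x = c (inv h z)} {x. x \<in> {..<m} \<and> col_of lam x = col_of lam z}"
    if "z < m" for z
    by (rule bij_betw_byWitness[where f' = "inv h"]) (use hc ihm hm hi ih that in auto)
  have rel': "(\<Sum>x | x \<in> {..<m} \<and> col_of lam x = i. place_act m (transpose x y) v') = v'"
    if y: "y \<in> {..<m}" and i: "i < col_of lam y" for y i
  proof -
    obtain z where z: "z < m" "col_of lam z = i"
      using diagram_down_closed[OF lam(1), of y i "row_of lam y"] y i lam(2) by auto
    let ?z = "inv h z" and ?y = "inv h y"
    \<comment> \<open>Columns weakly shorten to the right, so the extremal relation, which needs a
      target block at least as large, holds for every column to the left of
      \<open>y\<close>.\<close>
    have "card {x. x \<in> {..<m} \<and> col_of lam x = col_of lam y} \<le> card {x. x \<in> {..<m} \<and> col_of lam x = col_of lam z}"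
      using card_col[of lam "col_of lam y"] card_col[of lam "col_of lam z"] lam(2) i z(2)
      by (auto intro!: card_mono)
    then have "card {x \<in> {..<m}. c x = c ?y} \<le> card {x \<in> {..<m}. c x = c ?z}"
      using bij_betw_same_card[OF fiber[of y]] bij_betw_same_card[OF fiber[of z]] y z by simp
    moreover have "c ?y \<noteq> c ?z" using hc[of ?y ?z] y z i by (simp add: ihm hi)
    ultimately have "(\<Sum>x | x \<in> {..<m} \<and> c x = c ?z. place_act m (transpose x ?y) v) = v"
      using y by (intro rel[rule_format]) (auto simp: ihm)
    then have "v' = place_act m h (\<Sum>x | x \<in> {..<m} \<and> c x = c ?z. place_act m (transpose x ?y) v)"
      by (simp add: v'_def)
    also have "\<dots> = (\<Sum>x | x \<in> {..<m} \<and> c x = c ?z. place_act m h (place_act m (transpose x ?y) v))"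
      using h by (rule pos.act_sum)
    also have "\<dots> = (\<Sum>x | x \<in> {..<m} \<and> c x = c ?z. place_act m (transpose (h x) y) v')"
      using y pos.act_conj[OF h, of _ ?y v] by (intro sum.cong refl) (simp add: ihm hi v'_def)
    also have "\<dots> = (\<Sum>x | x \<in> {..<m} \<and> col_of lam x = i. place_act m (transpose x y) v')"
      using fiber[OF z(1)] unfolding z(2) by (rule sum.reindex_bij_betw)
    finally show ?thesis by (rule sym)
  qed
  have nz: "pos.stab_sum (row_of lam) v' \<noteq> 0"
    using diagram_down_closed[OF lam(1)] inj_on_col_row[of lam] anti' rel' v'(2)
    unfolding lam(2) by (rule pos.stab_sum_nonzero)
  obtain T' where T': "T' \<in> tensor_space ?n m" "v' = ?F T'" using v'(1) by (auto simp: X_def)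
  have "part lam 1 \<le> k"
  proof (rule ccontr)
    assume "\<not> ?thesis"
    then have "Suc k \<le> card {x \<in> {..<m}. row_of lam x = 0}" using card_row[of lam 0] lam(2) by simp
    then obtain S where S: "S \<subseteq> {x \<in> {..<m}. row_of lam x = 0}" "card S = Suc k"
      by (meson obtain_subset_with_card_n)
    then have Sm: "S \<subseteq> {..<m}" and S0: "\<And>x. x \<in> S \<Longrightarrow> row_of lam x = 0" by blast+
    \<comment> \<open>A first row with more than \<open>k\<close> cells contains such an
      \<open>S\<close>; row symmetrization absorbs symmetrizing over \<open>S\<close> up to a
      factorial, and so would kill \<open>v'\<close>.\<close>
    have "pos.sym_sum S v' = 0" using v'(1) Sm S(2) by (simp add: X_def)
    moreover have "pos.stab_sum (row_of lam) (pos.sym_sum S v')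
        = fscale (of_nat (card {p. p permutes S})) (pos.stab_sum (row_of lam) v')"
      using Sm by (rule pos.stab_sum_sym_sum) (simp add: S0)
    moreover have "card {p. p permutes S} \<noteq> 0"
      using finite_subset[OF Sm] by (simp add: card_permutations[OF refl])
    ultimately show False using nz by (simp add: pos.stab_sum_zero)
  qed
  moreover have "r_mult lam mu > 0"
  proof (rule r_mult_pos_of_vector)
    \<comment> \<open>The Schur element of a preimage \<open>T'\<close> of \<open>v'\<close>. As the
      letter operator commutes with places and \<open>v'\<close> is already column-alternating, its
      image is a nonzero multiple of the row symmetrization of \<open>v'\<close>.\<close>
    let ?w = "pos.stab_sum (row_of lam) (pos.stab_alt (col_of lam) T')"
    show "?w \<in> schur_module lam ?n" using T'(1) by (auto simp: schur_module_eq lam(2))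
    have "?F ?w = pos.stab_sum (row_of lam) (pos.stab_alt (col_of lam) v')"
      unfolding F_sum F_alt T'(2) ..
    also have "pos.stab_alt (col_of lam) v' = fscale (of_nat (card (label_stabilizer {..<m} (col_of lam)))) v'"
      using anti' by (rule pos.stab_alt_alternating)
    finally have "?F ?w = fscale (of_nat (card (label_stabilizer {..<m} (col_of lam)))) (pos.stab_sum (row_of lam) v')"
      by (simp only: pos.stab_sum_scale)
    moreover have "of_nat (card (label_stabilizer {..<m} (col_of lam))) \<noteq> (0 :: complex)"
      using pos.card_label_stabilizer_pos[of "col_of lam"] by simp
    ultimately show "?F ?w \<noteq> 0"
      using nz by (simp only: fun_space.scale_eq_0_iff de_Morgan_disj not_False_eq_True simp_thms)
  qed
  ultimately show ?thesis using lam(1) by blast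
qed

text \<open>Since parts weakly decrease, \<open>x \<le> part mu x\<close> holds on an initial
  segment of the naturals, and the bound says that \<open>Suc d\<close> is outside it. It always
  contains 0 and is bounded by the length, so \<open>GREATEST\<close> is meaningful.\<close>

lemma durfee_le_iff:
  assumes "is_partition mu"
  shows "durfee mu \<le> d \<longleftrightarrow> part mu (Suc d) \<le> d"
proof -
  have bound: "x \<le> length mu" if "x \<le> part mu x" for x using that by (auto simp: part_def split: if_splits)
  have D: "durfee mu \<le> part mu (durfee mu)"
    unfolding durfee_def by (rule GreatestI_nat[where k = 0 and b = "length mu"]) (simp_all add: bound)
  have max: "x \<le> durfee mu" if "x \<le> part mu x" for x
    unfolding durfee_def using that bound by (rule Greatest_le_nat)
  have mono: "part mu j \<le> part mu i" if "1 \<le> i" "i \<le> j" for i j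
    using that is_partition_nth_mono[OF assms, of "i - 1" "j - 1"] by (auto simp: part_def)
  show ?thesis
  proof
    assume "durfee mu \<le> d"
    then show "part mu (Suc d) \<le> d" using max[of "Suc d"] by linarith
  next
    assume "part mu (Suc d) \<le> d"
    then show "durfee mu \<le> d" using mono[of "Suc d" "durfee mu"] D by linarith
  qed
qed

theorem theorem1p5:
  fixes mu :: "nat list" and k :: nat
  assumes "is_partition mu" and "1 \<le> k"
  shows "(\<exists>lam. is_partition lam \<and> part lam 1 \<le> k \<and> r_mult lam mu > 0)
         \<longleftrightarrow> durfee mu \<le> 2 ^ (k - 1)"
  unfolding durfee_le_iff[OF assms(1)]
  using part_le_of_r_mult_pos[OF assms] exists_partition_of_hook[OF assms] by blast

end
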